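(* Let $D\subseteq\mathbb{C}$ be a domain, let $\mathcal{F}$ be a family of meromorphic functions on $D$, and let $a,b,c$ be three distinct complex numbers. Suppose there exist a holomorphic function $h$ on $D$ and a constant $\rho>0$ such that for each $f\in\mathcal{F}$ there are values $c_f,d_f\in D^*_\rho(0)$ (depending on $f$) for which $f$ and $f'$ partially share the three pairs $(a,h)$, $(b,c_f)$ and $(c,d_f)$ on $D$; that is, for every $z\in D$: $f(z)=a$ implies $f'(z)=h(z)$; $f(z)=b$ implies $f'(z)=c_f$; and $f(z)=c$ implies $f'(z)=d_f$. Then $\mathcal{F}$ is normal in $D$.
   Context: $D^*_\rho(0)=\{z\in\mathbb{C}:0<|z|<\rho\}$ is the punctured disk. Two meromorphic functions $f,g$ on $D$ partially share a pair $(\alpha,\beta)$, where $\alpha\in\mathbb{C}$ and $\beta$ is a complex number or a holomorphic function on $D$, if for every $z\in D$, $f(z)=\alpha$ implies $g(z)=\beta$ (respectively $g(z)=\beta(z)$). A family $\mathcal{F}$ of meromorphic functions on $D$ is normal in $D$ if every sequence in $\mathcal{F}$ has a subsequence converging locally uniformly in $D$ with respect to the spherical metric; the limit is a meromorphic function on $D$ or identically $\infty$. *)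

theory Defs
  imports "HOL-Complex_Analysis.Complex_Analysis"
begin

text \<open>The Riemann sphere is modelled as \<^typ>\<open>complex option\<close>, with \<^const>\<open>None\<close> as the point at infinity.\<close>

type_synonym riemann_sphere = "complex option"

text \<open>
  Inverse stereographic projection onto the unit sphere of \<^typ>\<open>complex \<times> real\<close>.
\<close>

definition sphere_point :: "riemann_sphere \<Rightarrow> complex \<times> real" where
  "sphere_point p =
     (case p of
        None \<Rightarrow> (0, 1)
      | Some z \<Rightarrow> (2 * z / of_real (1 + (norm z)\<^sup>2), ((norm z)\<^sup>2 - 1) / (1 + (norm z)\<^sup>2)))"

text \<open>The spherical metric is the great-circle distance, i.e. the angle between unit vectors.\<close>

definition spherical_dist :: "riemann_sphere \<Rightarrow> riemann_sphere \<Rightarrow> real" where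
  "spherical_dist p q = arccos (sphere_point p \<bullet> sphere_point q)"

text \<open>
  A meromorphic function on \<open>D\<close> is an \<open>f :: complex \<Rightarrow> complex\<close> with \<open>f nicely_meromorphic_on D\<close>:
  removable singularities have been removed, and \<open>f\<close> is assigned the junk value 0 at its poles.
  The following is its true value, which is infinity at the poles (so that a pole is not
  mistaken for a zero).
\<close>

definition mero_value :: "(complex \<Rightarrow> complex) \<Rightarrow> complex \<Rightarrow> riemann_sphere" where
  "mero_value f z = (if is_pole f z then None else Some (f z))"

text \<open>A constant value \<open>c\<close> in the second component of a pair is given as \<open>\<lambda>_. c\<close>.\<close>

definition partially_share ::
  "complex set \<Rightarrow> (complex \<Rightarrow> complex) \<Rightarrow> (complex \<Rightarrow> complex) \<Rightarrow> complex \<Rightarrow> (complex \<Rightarrow> complex) \<Rightarrow> bool"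
where
  "partially_share D f g \<alpha> \<beta> \<longleftrightarrow>
     (\<forall>z\<in>D. mero_value f z = Some \<alpha> \<longrightarrow> mero_value g z = Some (\<beta> z))"

definition spherically_locally_uniform_limit ::
  "complex set \<Rightarrow> (nat \<Rightarrow> complex \<Rightarrow> riemann_sphere) \<Rightarrow> (complex \<Rightarrow> riemann_sphere) \<Rightarrow> bool"
where
  "spherically_locally_uniform_limit D \<phi> \<psi> \<longleftrightarrow>
     (\<forall>z\<in>D. \<exists>U. open U \<and> z \<in> U \<and> U \<subseteq> D \<and>
        (\<forall>\<epsilon>>0. \<forall>\<^sub>F n in sequentially. \<forall>w\<in>U. spherical_dist (\<phi> n w) (\<psi> w) < \<epsilon>))"

definition normal_family :: "complex set \<Rightarrow> (complex \<Rightarrow> complex) set \<Rightarrow> bool" where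
  "normal_family D \<F> \<longleftrightarrow>
     (\<forall>f :: nat \<Rightarrow> complex \<Rightarrow> complex. range f \<subseteq> \<F> \<longrightarrow>
        (\<exists>r \<psi>. strict_mono r \<and>
           spherically_locally_uniform_limit D (\<lambda>n. mero_value (f (r n))) \<psi> \<and>
           ((\<exists>g. g nicely_meromorphic_on D \<and> (\<forall>z\<in>D. \<psi> z = mero_value g z)) \<or>
            (\<forall>z\<in>D. \<psi> z = None))))"

end

theory Submission
  imports Defs "HOL-Library.Diagonal_Subsequence"
begin

text \<open>
  The proof is a rescaling argument. A meromorphic function is regarded as a map into the sphere
  that is holomorphic in one of the two charts \<open>w\<close> and \<open>1/w\<close>, and its size is measured by the
  spherical derivative \<open>|f'| / (1 + |f|\<^sup>2)\<close>. By Marty's criterion (lemma \<open>Marty\<close>) normality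
  follows once the spherical derivatives of all members of the family are bounded near every point.
  Suppose that they are unbounded near some point. Zalcman's device (\<open>Zalcman_rescaling\<close>) yields
  members \<open>f\<^sub>n\<close>, points \<open>\<zeta>\<^sub>n\<close> and scales \<open>t\<^sub>n \<rightarrow> 0\<close> such that the functions
  \<open>g\<^sub>n(w) = f\<^sub>n(\<zeta>\<^sub>n + t\<^sub>n w)\<close> have spherical derivative 1 at 0 and at most 2 on discs that exhaust the
  plane. A subsequence converges to a map \<open>\<psi>\<close> from the plane to the sphere, which is not constant and
  has bounded spherical derivative.

  The three shared pairs give the following information on \<open>\<psi>\<close>. At a \<open>b\<close>-point the derivative of
  \<open>g\<^sub>n\<close> is \<open>t\<^sub>n c\<^sub>f\<close>, a nonzero constant on that fibre that tends to 0. The \<open>b\<close>-points of \<open>g\<^sub>n\<close> are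
  therefore simple and \<open>g\<^sub>n' - t\<^sub>n c\<^sub>f\<close> vanishes at all of them, so that
  \<open>(g\<^sub>n' - t\<^sub>n c\<^sub>f) / (g\<^sub>n - b)\<close> is holomorphic. The maximum principle bounds these quotients uniformly,
  and the limit satisfies \<open>|\<psi>'| \<le> M |\<psi> - b|\<close>, which is impossible near a \<open>b\<close>-point of a nonconstant
  function. Hence \<open>\<psi>\<close> omits \<open>b\<close>, and likewise \<open>c\<close> (\<open>limit_omits_simple_value\<close>). At an \<open>a\<close>-point the
  derivative of \<open>g\<^sub>n\<close> is \<open>t\<^sub>n h\<close>, which tends to 0, so that by Hurwitz's theorem \<open>\<psi>\<close> is ramified at
  each of its \<open>a\<close>-points (\<open>limit_ramified_value\<close>).

  Such a \<open>\<psi>\<close> does not exist (\<open>no_entire_curve_omitting_two_ramified_over_third\<close>). Indeed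
  \<open>(\<psi> - b) / (\<psi> - c)\<close> is entire without zeros, hence equal to \<open>exp \<Phi>\<close>, and the bound on the
  spherical derivative bounds \<open>\<Phi>'\<close> on the set where \<open>Re \<Phi> = 0\<close>. Harnack's inequality spreads this
  bound over the whole plane: if \<open>d\<close> is the distance from \<open>z\<close> to that set, then the derivative at the
  nearest point of the set is at least \<open>|Re \<Phi>(z)| / 2d\<close>, while at \<open>z\<close> it is at most
  \<open>2 |Re \<Phi>(z)| / d\<close>. So \<open>\<Phi>'\<close> is bounded and \<open>\<Phi>\<close> is affine, and then \<open>\<psi>\<close> takes the value \<open>a\<close>
  with nonzero derivative.
\<close>

section \<open>Entire functions with derivative bounded on the zero set of the real part\<close>

text \<open>
  Both inequalities are the Schwarz lemma for the Cayley transform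
  \<open>(p - p(0)) / (p + cnj p(0))\<close>, which maps the disc into itself and fixes 0.
\<close>

lemma right_half_plane_Harnack:
  assumes holp: "p holomorphic_on ball 0 1" and pos: "\<And>z. z \<in> ball 0 1 \<Longrightarrow> 0 < Re (p z)"
  shows "norm (deriv p 0) \<le> 2 * Re (p 0)"
    and "\<lbrakk>0 \<le> t; t < 1\<rbrakk> \<Longrightarrow> Re (p 0) * (1 - t) / (1 + t) \<le> Re (p (of_real t))"
proof -
  define R where "R = Re (p 0)"
  have R: "R > 0" using pos[of 0] by (simp add: R_def)
  define W where "W z = (p z - p 0) / (p z + cnj (p 0))" for z
  have nz: "p z + cnj (p 0) \<noteq> 0" if "z \<in> ball 0 1" for z
  proof
    assume "p z + cnj (p 0) = 0"
    then have "Re (p z) + R = 0" by (metis R_def cnj.simps(1) plus_complex.simps(1) zero_complex.simps(1))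
    then show False using pos[OF that] R by simp
  qed
  have holW: "W holomorphic_on ball 0 1"
    unfolding W_def by (intro holomorphic_intros holp) (use nz in auto)
  have W0: "W 0 = 0" by (simp add: W_def)
  have Wlt: "norm (W z) < 1" if "norm z < 1" for z
  proof -
    have z: "z \<in> ball 0 1" using that by simp
    have "(norm (p z - p 0))\<^sup>2 < (norm (p z + cnj (p 0)))\<^sup>2"
    proof -
      have "(norm (p z + cnj (p 0)))\<^sup>2 - (norm (p z - p 0))\<^sup>2 = 4 * Re (p z) * R"
        by (simp add: cmod_power2 R_def) (simp add: power2_eq_square algebra_simps)
      moreover have "4 * Re (p z) * R > 0" using pos[OF z] R by simp
      ultimately show ?thesis by linarith
    qed
    then have "norm (p z - p 0) < norm (p z + cnj (p 0))"
      using norm_ge_zero power_less_imp_less_base by blast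
    then show ?thesis using nz[OF z] by (simp add: W_def norm_divide)
  qed
  have dW: "(W has_field_derivative (deriv p 0 / (2 * of_real R))) (at 0)"
  proof -
    have dp: "(p has_field_derivative deriv p 0) (at 0)"
      using holp holomorphic_derivI by (metis centre_in_ball open_ball zero_less_one)
    have s: "p 0 + cnj (p 0) = 2 * of_real R" by (simp add: complex_add_cnj R_def)
    show ?thesis unfolding W_def
      by (rule derivative_eq_intros dp refl nz | use nz[of 0] R in \<open>simp add: s\<close>)+
  qed
  have "norm (deriv W 0) \<le> 1" using Schwarz_Lemma(2)[OF holW W0 Wlt, of 0] by simp
  then have "norm (deriv p 0) / (2 * R) \<le> 1"
    using DERIV_imp_deriv[OF dW] R by (simp add: norm_divide norm_mult)
  then show "norm (deriv p 0) \<le> 2 * Re (p 0)" using R by (simp add: R_def divide_simps)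
  assume t: "0 \<le> t" "t < 1"
  define z where "z = complex_of_real t"
  have z1: "norm z < 1" "z \<in> ball 0 1" using t by (auto simp: z_def)
  have Wt: "norm (W z) \<le> t" using Schwarz_Lemma(1)[OF holW W0 Wlt z1(1)] t by (simp add: z_def)
  define X where "X = Re (p z)"
  have X: "X > 0" using pos z1 by (simp add: X_def)
  have 1: "norm (p z - p 0) \<le> t * norm (p z + cnj (p 0))"
    using Wt nz[OF z1(2)] by (simp add: W_def norm_divide divide_simps)
  define Y where "Y = (Im (p z) - Im (p 0))\<^sup>2"
  have "(norm (p z - p 0))\<^sup>2 \<le> (t * norm (p z + cnj (p 0)))\<^sup>2"
    by (rule power_mono[OF 1]) simp
  moreover have "(norm (p z - p 0))\<^sup>2 = (X - R)\<^sup>2 + Y" "(norm (p z + cnj (p 0)))\<^sup>2 = (X + R)\<^sup>2 + Y"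
    by (simp_all add: cmod_power2 X_def R_def Y_def)
  ultimately have "(X - R)\<^sup>2 + Y \<le> t\<^sup>2 * ((X + R)\<^sup>2 + Y)" by (simp add: power_mult_distrib)
  moreover have "t\<^sup>2 * Y \<le> Y" using t by (simp add: Y_def mult_left_le_one_le power_le_one)
  ultimately have "(X - R)\<^sup>2 \<le> (t * (X + R))\<^sup>2"
    unfolding power_mult_distrib distrib_left[of "t\<^sup>2"] by linarith
  then have "\<bar>X - R\<bar> \<le> t * (X + R)" using X R t by (metis abs_le_square_iff abs_of_nonneg add_nonneg_nonneg less_eq_real_def mult_nonneg_nonneg)
  then have "R * (1 - t) \<le> X * (1 + t)" by (simp add: algebra_simps abs_if split: if_splits)
  then show "Re (p 0) * (1 - t) / (1 + t) \<le> Re (p (of_real t))"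
    using t by (simp add: R_def X_def z_def divide_simps)
qed

lemma entire_Re_pos_imp_deriv_0:
  assumes hol: "\<phi> holomorphic_on UNIV" and pos: "\<And>z. Re (\<phi> z) > 0"
  shows "deriv \<phi> z = 0"
proof -
  have "(\<lambda>z. exp (- \<phi> z)) holomorphic_on UNIV" by (intro holomorphic_intros hol)
  moreover have "bounded (range (\<lambda>z. exp (- \<phi> z)))"
    unfolding bounded_iff using pos by (auto intro!: exI[of _ 1] simp: less_imp_le)
  ultimately have "(\<lambda>z. exp (- \<phi> z)) constant_on UNIV" by (rule Liouville_theorem)
  then obtain k where k: "\<And>z. exp (- \<phi> z) = k" by (auto simp: constant_on_def)
  have d: "(\<phi> has_field_derivative deriv \<phi> z) (at z)" using hol holomorphic_derivI by blast
  have "((\<lambda>z. exp (- \<phi> z)) has_field_derivative (exp (- \<phi> z) * (- deriv \<phi> z))) (at z)"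
    by (rule derivative_eq_intros d refl | simp)+
  moreover have "((\<lambda>z. exp (- \<phi> z)) has_field_derivative 0) (at z)" unfolding k by simp
  ultimately have "exp (- \<phi> z) * (- deriv \<phi> z) = 0" by (rule DERIV_unique)
  then show ?thesis by simp
qed

text \<open>
  Let \<open>d\<close> be the distance from \<open>z\<close> to the zero set of \<open>Re \<phi>\<close>, attained at \<open>z2\<close>, and put
  \<open>R = Re \<phi>(z)\<close>. On the disc of radius \<open>d\<close> about \<open>z\<close> the real part is positive. The Harnack lower bound
  along the radius towards \<open>z2\<close> gives \<open>R / 2 \<le> d |\<phi>'(z2)| \<le> d |C|\<close>, and the gradient bound at the
  centre gives \<open>d |\<phi>'(z)| \<le> 2 R\<close>. If the real part has no zero, \<open>\<phi>\<close> is constant.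
\<close>

lemma entire_deriv_bound_where_Re_pos:
  assumes hol: "\<phi> holomorphic_on UNIV"
    and bnd: "\<And>z. Re (\<phi> z) = 0 \<Longrightarrow> norm (deriv \<phi> z) \<le> C"
    and pos: "Re (\<phi> z) > 0"
  shows "norm (deriv \<phi> z) \<le> 4 * \<bar>C\<bar>"
proof (cases "\<exists>w. Re (\<phi> w) = 0")
  case False
  have cont: "continuous_on UNIV (\<lambda>z. Re (\<phi> z))"
    by (intro continuous_intros holomorphic_on_imp_continuous_on hol)
  have "Re (\<phi> w) > 0" for w
  proof (rule ccontr)
    assume "\<not> Re (\<phi> w) > 0"
    then have "Re (\<phi> w) \<le> 0" by simp
    moreover have "connected ((\<lambda>z. Re (\<phi> z)) ` UNIV)"
      by (rule connected_continuous_image[OF cont]) (rule connected_UNIV)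
    ultimately have "0 \<in> (\<lambda>z. Re (\<phi> z)) ` UNIV"
      using pos unfolding connected_iff_interval by (metis less_imp_le rangeI)
    then show False using False by auto
  qed
  then show ?thesis using entire_Re_pos_imp_deriv_0[OF hol] by simp
next
  case True
  define Z where "Z = {w. Re (\<phi> w) = 0}"
  have cont: "continuous_on UNIV (\<lambda>z. Re (\<phi> z))"
    by (intro continuous_intros holomorphic_on_imp_continuous_on hol)
  have "closed Z" unfolding Z_def by (rule closed_Collect_eq[OF cont]) simp
  moreover have "Z \<noteq> {}" using True by (auto simp: Z_def)
  ultimately obtain z2 where z2: "z2 \<in> Z" "\<And>y. y \<in> Z \<Longrightarrow> dist z z2 \<le> dist z y"
    using distance_attains_inf by metis
  define d where "d = dist z z2"
  have "z \<noteq> z2" using z2 pos by (auto simp: Z_def)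
  then have d: "d > 0" by (simp add: d_def)
  have ballpos: "Re (\<phi> w) > 0" if "w \<in> ball z d" for w
  proof (rule ccontr)
    assume "\<not> Re (\<phi> w) > 0"
    then have "Re (\<phi> w) \<le> 0" by simp
    moreover have "connected ((\<lambda>z. Re (\<phi> z)) ` ball z d)"
      by (rule connected_continuous_image[OF continuous_on_subset[OF cont]]) auto
    moreover have "z \<in> ball z d" using d by simp
    ultimately have "0 \<in> (\<lambda>z. Re (\<phi> z)) ` ball z d"
      using pos that unfolding connected_iff_interval by (meson imageI less_imp_le)
    then obtain y where "y \<in> ball z d" "y \<in> Z" by (auto simp: Z_def)
    then show False using z2(2)[of y] by (auto simp: d_def)
  qed
  \<comment> \<open>The disc is normalised so that the nearest zero \<open>z2\<close> corresponds to the boundary point 1.\<close>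
  define p where "p t = \<phi> (z + (z2 - z) * t)" for t
  have nzz: "norm (z2 - z) = d" by (simp add: d_def dist_norm norm_minus_commute)
  have inb: "z + (z2 - z) * t \<in> ball z d" if "t \<in> ball 0 1" for t
    using that d by (auto simp: dist_norm norm_mult nzz)
  have holp: "p holomorphic_on ball 0 1" unfolding p_def
    by (rule holomorphic_on_compose_gen[OF _ hol, of "\<lambda>t. z + (z2 - z) * t" "ball 0 1", unfolded o_def])
       (auto intro!: holomorphic_intros)
  have dp: "(p has_field_derivative (deriv \<phi> (z + (z2 - z) * t) * (z2 - z))) (at t)" for t
  proof -
    have "(\<phi> has_field_derivative deriv \<phi> (z + (z2 - z) * t)) (at (z + (z2 - z) * t))"
      using hol holomorphic_derivI by blast
    then show ?thesis unfolding p_def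
      by (rule DERIV_chain2) (rule derivative_eq_intros refl | simp)+
  qed
  have posp: "Re (p t) > 0" if "t \<in> ball 0 1" for t
    using ballpos inb[OF that] by (simp add: p_def)
  define R where "R = Re (\<phi> z)"
  have p0: "p 0 = \<phi> z" and p1: "Re (p 1) = 0" using z2 by (auto simp: p_def Z_def)
  have "norm (deriv p 0) \<le> 2 * R"
    using right_half_plane_Harnack(1)[OF holp posp] by (simp add: p0 R_def)
  then have A: "norm (deriv \<phi> z) * d \<le> 2 * R"
    using DERIV_imp_deriv[OF dp[of 0]] by (simp add: norm_mult nzz)
  \<comment> \<open>Harnack gives \<open>q s \<ge> R (1 - s) / (1 + s)\<close>, and \<open>q 1 = 0\<close>: the slope of \<open>q\<close> at 1 is at most \<open>- R / 2\<close>.\<close>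
  define q where "q = (\<lambda>s::real. Re (p (of_real s)))"
  have dq: "(q has_real_derivative Re (deriv \<phi> z2 * (z2 - z))) (at 1)"
  proof -
    have "(p has_field_derivative (deriv \<phi> z2 * (z2 - z))) (at (of_real 1))" using dp[of 1] by simp
    from has_vector_derivative_real_field[OF this]
    have "((\<lambda>s. p (of_real s)) has_vector_derivative (deriv \<phi> z2 * (z2 - z))) (at 1)" .
    then have "((\<lambda>s. Re (p (of_real s))) has_vector_derivative Re (deriv \<phi> z2 * (z2 - z))) (at 1)"
      using bounded_linear.has_vector_derivative[OF bounded_linear_Re] by blast
    then show ?thesis unfolding q_def by (simp add: has_real_derivative_iff_has_vector_derivative)
  qed
  have lim: "((\<lambda>t. (q t - q 1) / (t - 1)) \<longlongrightarrow> Re (deriv \<phi> z2 * (z2 - z))) (at_left 1)"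
    using dq unfolding has_field_derivative_iff
    by (rule filterlim_mono[OF _ order_refl]) (simp add: at_le)
  have q1: "q 1 = 0" using p1 by (simp add: q_def)
  have "\<forall>\<^sub>F t in at_left (1::real). (q t - q 1) / (t - 1) \<le> - (R / 2)"
  proof -
    have "\<forall>\<^sub>F t in at_left (1::real). t \<in> {0<..<1}"
      by (rule eventually_at_left_real) simp
    then show ?thesis
    proof eventually_elim
      case (elim t)
      have "R * (1 - t) / (1 + t) \<le> q t"
        using right_half_plane_Harnack(2)[OF holp posp, of t] elim by (simp add: p0 R_def q_def)
      moreover have "R * (1 - t) / 2 \<le> R * (1 - t) / (1 + t)"
        using elim pos by (intro divide_left_mono) (auto simp: R_def)
      ultimately have "R * (1 - t) / 2 \<le> q t" by linarith
      then show ?case using elim q1 by (simp add: divide_simps) (simp add: algebra_simps)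
    qed
  qed
  then have "Re (deriv \<phi> z2 * (z2 - z)) \<le> - (R / 2)"
    using tendsto_upperbound[OF lim] by simp
  then have "R / 2 \<le> norm (deriv \<phi> z2 * (z2 - z))"
    using abs_Re_le_cmod[of "deriv \<phi> z2 * (z2 - z)"] by linarith
  also have "\<dots> \<le> \<bar>C\<bar> * d"
    using bnd[of z2] z2(1) d by (auto simp: norm_mult nzz Z_def intro!: mult_right_mono)
  finally have "norm (deriv \<phi> z) * d \<le> 4 * \<bar>C\<bar> * d" using A by linarith
  then show ?thesis using d by simp
qed

text \<open>
  The bound on the left half plane is the one on the right applied to \<open>- \<phi>\<close>; then Liouville's
  theorem makes the derivative constant.
\<close>

lemma entire_affine_if_deriv_bounded_where_Re_0:
  assumes hol: "\<phi> holomorphic_on UNIV"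
    and bnd: "\<And>z. Re (\<phi> z) = 0 \<Longrightarrow> norm (deriv \<phi> z) \<le> C"
  obtains \<alpha> \<beta> where "\<And>z. \<phi> z = \<alpha> * z + \<beta>"
proof -
  have B: "norm (deriv \<phi> z) \<le> 4 * \<bar>C\<bar>" for z
  proof -
    consider "Re (\<phi> z) = 0" | "Re (\<phi> z) > 0" | "Re (- \<phi> z) > 0" by fastforce
    then show ?thesis
    proof cases
      case 1 then show ?thesis using bnd[of z] by linarith
    next
      case 2 then show ?thesis using entire_deriv_bound_where_Re_pos[OF hol bnd] by blast
    next
      case 3
      have d: "deriv (\<lambda>z. - \<phi> z) w = - deriv \<phi> w" for w
        by (rule DERIV_imp_deriv) (use hol holomorphic_derivI in \<open>blast intro: DERIV_minus\<close>)
      have "norm (deriv (\<lambda>z. - \<phi> z) z) \<le> 4 * \<bar>C\<bar>"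
        by (rule entire_deriv_bound_where_Re_pos) (use 3 bnd hol in \<open>auto simp: d intro!: holomorphic_intros\<close>)
      then show ?thesis by (simp add: d)
    qed
  qed
  have "deriv \<phi> holomorphic_on UNIV" using hol by (simp add: holomorphic_deriv)
  moreover have "bounded (range (deriv \<phi>))" using B by (auto simp: bounded_iff)
  ultimately have "deriv \<phi> constant_on UNIV" by (rule Liouville_theorem)
  then obtain \<alpha> where a: "\<And>z. deriv \<phi> z = \<alpha>" by (auto simp: constant_on_def)
  have "((\<lambda>z. \<phi> z - \<alpha> * z) has_field_derivative 0) (at z)" for z
  proof -
    have "(\<phi> has_field_derivative \<alpha>) (at z)" using a hol holomorphic_derivI by (metis UNIV_I open_UNIV)
    from DERIV_diff[OF this DERIV_cmult_Id[of \<alpha>]] show ?thesis by simp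
  qed
  then obtain \<beta> where "\<And>z. \<phi> z - \<alpha> * z = \<beta>"
    using has_field_derivative_zero_constant[of UNIV "\<lambda>z. \<phi> z - \<alpha> * z"] by auto
  then have "\<And>z. \<phi> z = \<alpha> * z + \<beta>" by (simp add: algebra_simps)
  then show ?thesis by (rule that)
qed

section \<open>Values of locally uniform limits of holomorphic functions\<close>

text \<open>
  At a zero of \<open>P\<close> the quotient \<open>N / P\<close> tends to the quotient of the derivatives, so the singularity is
  removable.
\<close>

lemma holomorphic_quotient_at_simple_zeros:
  assumes S: "open S" and holN: "N holomorphic_on S" and holP: "P holomorphic_on S"
    and zer: "\<And>z. \<lbrakk>z \<in> S; P z = 0\<rbrakk> \<Longrightarrow> N z = 0 \<and> deriv P z \<noteq> 0"
  obtains Q where "Q holomorphic_on S" "\<And>z. z \<in> S \<Longrightarrow> N z = Q z * P z"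
proof -
  define Q where "Q z = (if P z = 0 then deriv N z / deriv P z else N z / P z)" for z
  have "Q field_differentiable at z" if z: "z \<in> S" for z
  proof (cases "P z = 0")
    case False
    have "isCont P z" using holP S z by (meson continuous_on_eq_continuous_at holomorphic_on_imp_continuous_on)
    then have "\<forall>\<^sub>F w in at z. P w \<noteq> 0" using False isCont_def tendsto_imp_eventually_ne by blast
    then have ev: "\<forall>\<^sub>F w in nhds z. P w \<noteq> 0" using False by (simp add: eventually_nhds_conv_at)
    have "(\<lambda>w. N w / P w) field_differentiable at z"
      using holN holP S z False by (intro field_differentiable_divide) (auto simp: holomorphic_on_imp_differentiable_at)
    then obtain l where "((\<lambda>w. N w / P w) has_field_derivative l) (at z)"
      by (auto simp: field_differentiable_def)
    moreover have "\<forall>\<^sub>F w in nhds z. N w / P w = Q w" using ev by eventually_elim (simp add: Q_def)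
    ultimately have "(Q has_field_derivative l) (at z)" using DERIV_cong_ev[OF refl _ refl, of "\<lambda>w. N w / P w" Q z l] by simp
    then show ?thesis by (auto simp: field_differentiable_def)
  next
    case True
    have N0: "N z = 0" and dP: "deriv P z \<noteq> 0" using zer[OF z True] by auto
    have DN: "(N has_field_derivative deriv N z) (at z)" and DP: "(P has_field_derivative deriv P z) (at z)"
      using holN holP S z holomorphic_derivI by blast+
    have LN: "((\<lambda>w. N w / (w - z)) \<longlongrightarrow> deriv N z) (at z)" and LP: "((\<lambda>w. P w / (w - z)) \<longlongrightarrow> deriv P z) (at z)"
      using DN DP N0 True by (simp_all add: has_field_derivative_iff)
    have "\<forall>\<^sub>F w in at z. P w / (w - z) \<noteq> 0" using LP dP tendsto_imp_eventually_ne by blast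
    then have ev: "\<forall>\<^sub>F w in at z. P w \<noteq> 0" by eventually_elim auto
    then obtain r where r: "r > 0" "\<And>w. \<lbrakk>w \<noteq> z; dist w z < r\<rbrakk> \<Longrightarrow> P w \<noteq> 0"
      unfolding eventually_at by auto
    obtain r' where r': "r' > 0" "ball z r' \<subseteq> S" using S z open_contains_ball by blast
    define e where "e = min r r'"
    have e: "e > 0" "ball z e \<subseteq> S" using r r' by (auto simp: e_def)
    have Pnz: "P w \<noteq> 0" if "w \<in> ball z e - {z}" for w using that r(2)[of w] by (auto simp: e_def dist_commute)
    have "(\<lambda>w. N w / P w) holomorphic_on ball z e - {z}"
      by (intro holomorphic_intros holomorphic_on_subset[OF holN] holomorphic_on_subset[OF holP]) (use e Pnz in auto)
    then have hq: "Q holomorphic_on ball z e - {z}"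
      by (rule holomorphic_transform) (use Pnz in \<open>auto simp: Q_def\<close>)
    have "((\<lambda>w. (N w / (w - z)) / (P w / (w - z))) \<longlongrightarrow> deriv N z / deriv P z) (at z)"
      by (intro tendsto_divide LN LP dP)
    moreover have "\<forall>\<^sub>F w in at z. (N w / (w - z)) / (P w / (w - z)) = Q w"
      using ev eventually_neq_at_within[of z z UNIV] by eventually_elim (auto simp: Q_def)
    ultimately have "(Q \<longlongrightarrow> deriv N z / deriv P z) (at z)" by (rule Lim_transform_eventually)
    then have cz: "isCont Q z" by (simp add: isCont_def Q_def True)
    have "continuous_on (ball z e) Q"
    proof (rule continuous_at_imp_continuous_on, rule ballI)
      fix w assume w: "w \<in> ball z e"
      show "isCont Q w"
      proof (cases "w = z")
        case False
        have "continuous_on (ball z e - {z}) Q" using hq holomorphic_on_imp_continuous_on by blast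
        moreover have "open (ball z e - {z})" by (rule open_delete) simp
        ultimately show ?thesis using w False continuous_on_eq_continuous_at[of "ball z e - {z}" Q] by auto
      qed (use cz in simp)
    qed
    then have "Q holomorphic_on ball z e" by (rule no_isolated_singularity[where K = "{z}"]) (use hq in auto)
    then show ?thesis using e holomorphic_on_imp_differentiable_at[of Q "ball z e" z] by auto
  qed
  then have "Q holomorphic_on S" unfolding holomorphic_on_def using field_differentiable_at_within by blast
  moreover have "N z = Q z * P z" if "z \<in> S" for z using zer[OF that] by (auto simp: Q_def)
  ultimately show ?thesis by (rule that)
qed

text \<open>
  Cauchy's estimate for \<open>F n - G\<close> on circles of radius \<open>e/4\<close>.
\<close>

lemma uniform_limit_deriv:
  fixes F :: "nat \<Rightarrow> complex \<Rightarrow> complex"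
  assumes e: "e > 0" and holF: "\<And>n. F n holomorphic_on ball z e"
    and holG: "G holomorphic_on ball z e"
    and lim: "uniform_limit (ball z e) F G sequentially"
  shows "uniform_limit (ball z (e/2)) (\<lambda>n. deriv (F n)) (deriv G) sequentially"
proof (rule uniform_limitI)
  fix \<epsilon> :: real assume \<epsilon>: "\<epsilon> > 0"
  define \<delta> where "\<delta> = \<epsilon> * e / 8"
  have \<delta>: "\<delta> > 0" using \<epsilon> e by (simp add: \<delta>_def)
  have "\<forall>\<^sub>F n in sequentially. \<forall>w\<in>ball z e. dist (F n w) (G w) < \<delta>"
    using uniform_limitD[OF lim \<delta>] .
  then show "\<forall>\<^sub>F n in sequentially. \<forall>w\<in>ball z (e/2). dist (deriv (F n) w) (deriv G w) < \<epsilon>"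
  proof (rule eventually_mono, intro ballI)
    fix n w assume n: "\<forall>w\<in>ball z e. dist (F n w) (G w) < \<delta>" and w: "w \<in> ball z (e/2)"
    have sub: "cball w (e/4) \<subseteq> ball z e"
    proof
      fix y assume "y \<in> cball w (e/4)"
      then show "y \<in> ball z e" using w e dist_triangle[of z y w] by simp
    qed
    have hol: "(\<lambda>w. F n w - G w) holomorphic_on ball z e" by (intro holomorphic_intros holF holG)
    have "norm ((deriv ^^ 1) (\<lambda>w. F n w - G w) w) \<le> fact 1 * \<delta> / (e/4) ^ 1"
    proof (rule Cauchy_inequality)
      show "(\<lambda>w. F n w - G w) holomorphic_on ball w (e/4)"
        by (rule holomorphic_on_subset[OF hol]) (use sub ball_subset_cball in blast)
      show "continuous_on (cball w (e/4)) (\<lambda>w. F n w - G w)"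
        using holomorphic_on_imp_continuous_on[OF holomorphic_on_subset[OF hol sub]] .
      show "0 < e/4" using e by simp
      fix x assume "norm (w - x) = e/4"
      then have "x \<in> cball w (e/4)" by (simp add: dist_norm)
      then have "x \<in> ball z e" using sub by blast
      then have "dist (F n x) (G x) < \<delta>" using n by blast
      then show "norm (F n x - G x) \<le> \<delta>" by (simp add: dist_norm)
    qed
    moreover have "deriv (\<lambda>w. F n w - G w) w = deriv (F n) w - deriv G w"
      using w e holF holG by (intro deriv_diff holomorphic_on_imp_differentiable_at[of _ "ball z e"]) auto
    ultimately have "dist (deriv (F n) w) (deriv G w) \<le> \<delta> / (e/4)" by (simp add: dist_norm)
    also have "\<dots> < \<epsilon>" using e \<epsilon> by (simp add: \<delta>_def)
    finally show "dist (deriv (F n) w) (deriv G w) < \<epsilon>" .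
  qed
qed

text \<open>
  Every zero of \<open>F n - b\<close> is simple and is a zero of \<open>deriv (F n) - \<epsilon> n\<close>, so the quotient of the
  latter by the former is holomorphic. On a circle about \<open>z\<close> on which \<open>G - b\<close> has no zero the quotients
  are uniformly bounded, hence they are bounded inside by the same constant \<open>M\<close>. In the limit
  \<open>|G'| \<le> M |G - b|\<close>. At a zero of \<open>G - b\<close> of order \<open>k \<ge> 1\<close> this fails, because \<open>G'\<close> has order
  \<open>k - 1\<close> there.
\<close>

lemma Hurwitz_simple_value_omitted:
  fixes F :: "nat \<Rightarrow> complex \<Rightarrow> complex"
  assumes e: "e > 0" and holF: "\<And>n. F n holomorphic_on ball z e"
    and holG: "G holomorphic_on ball z e"
    and lim: "uniform_limit (ball z e) F G sequentially"
    and \<epsilon>: "\<epsilon> \<longlonglongrightarrow> 0" "\<And>n. \<epsilon> n \<noteq> 0"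
    and share: "\<And>n w. \<lbrakk>w \<in> ball z e; F n w = b\<rbrakk> \<Longrightarrow> deriv (F n) w = \<epsilon> n"
    and nonconst: "\<not> G constant_on ball z e"
  shows "G z \<noteq> b"
proof
  assume Gb: "G z = b"
  have hb: "(\<lambda>w. G w - b) holomorphic_on ball z e" by (intro holomorphic_intros holG)
  have nc: "\<not> (\<lambda>w. G w - b) constant_on ball z e"
    using nonconst unfolding constant_on_def by (metis diff_add_cancel)
  have zin: "z \<in> ball z e" and Gz0: "G z - b = 0" using e Gb by auto
  obtain g r k where k: "0 < k" and r: "0 < r" "ball z r \<subseteq> ball z e"
    and g: "g holomorphic_on ball z r" "\<And>w. w \<in> ball z r \<Longrightarrow> G w - b = (w - z) ^ k * g w"
      "\<And>w. w \<in> ball z r \<Longrightarrow> g w \<noteq> 0"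
    by (rule holomorphic_factor_zero_nonconstant[OF hb open_ball connected_ball zin Gz0 nc])
       (rule that; assumption)
  define s where "s = min r e / 3"
  have s: "s > 0" "s < r" "s < e/2" using r e by (auto simp: s_def)
  have cb: "cball z s \<subseteq> ball z (e/2)" "cball z s \<subseteq> ball z e" "cball z s \<subseteq> ball z r" using s by auto
  have cG: "continuous_on (cball z s) G" "continuous_on (cball z s) (deriv G)"
    using cb holomorphic_deriv[OF holG] holG by (auto intro!: holomorphic_on_imp_continuous_on intro: holomorphic_on_subset)
  have "\<exists>m>0. \<forall>w\<in>sphere z s. m \<le> norm (G w - b)"
  proof -
    have "continuous_on (sphere z s) (\<lambda>w. norm (G w - b))"
      by (intro continuous_intros continuous_on_subset[OF cG(1)]) auto
    moreover have "sphere z s \<noteq> {}" using s by simp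
    ultimately obtain x where x: "x \<in> sphere z s" "\<And>y. y \<in> sphere z s \<Longrightarrow> norm (G x - b) \<le> norm (G y - b)"
      using continuous_attains_inf[of "sphere z s"] compact_sphere by metis
    have "x \<in> ball z r" "x \<noteq> z" using x(1) s by auto
    then have "G x - b \<noteq> 0" using g(2,3)[of x] by auto
    then show ?thesis using x by (intro exI[of _ "norm (G x - b)"]) auto
  qed
  then obtain m where m: "m > 0" "\<And>w. w \<in> sphere z s \<Longrightarrow> m \<le> norm (G w - b)" by blast
  have "compact (deriv G ` cball z s)" by (rule compact_continuous_image[OF cG(2)]) simp
  then have "bounded (deriv G ` cball z s)" by (rule compact_imp_bounded)
  then obtain B where "\<forall>v\<in>deriv G ` cball z s. norm v \<le> B" unfolding bounded_iff by blast
  then have B: "norm (deriv G w) \<le> B" if "w \<in> cball z s" for w using that by blast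
  define M where "M = (B + 2) / (m / 2)"
  have ev1: "\<forall>\<^sub>F n in sequentially. \<forall>w\<in>ball z e. dist (F n w) (G w) < m/2"
    using uniform_limitD[OF lim, of "m/2"] m by simp
  have ev2: "\<forall>\<^sub>F n in sequentially. \<forall>w\<in>ball z (e/2). dist (deriv (F n) w) (deriv G w) < 1"
    using uniform_limitD[OF uniform_limit_deriv[OF e holF holG lim], of 1] by simp
  have ev3: "\<forall>\<^sub>F n in sequentially. dist (\<epsilon> n) 0 < 1" using \<epsilon>(1) tendstoD[of \<epsilon> 0 sequentially 1] by simp
  have key: "\<forall>\<^sub>F n in sequentially. \<forall>w\<in>cball z s. norm (deriv (F n) w - \<epsilon> n) \<le> M * norm (F n w - b)"
    using ev1 ev2 ev3
  proof eventually_elim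
    case (elim n)
    have hN: "(\<lambda>w. deriv (F n) w - \<epsilon> n) holomorphic_on ball z e"
      by (intro holomorphic_intros holomorphic_deriv holF) simp
    have hP: "(\<lambda>w. F n w - b) holomorphic_on ball z e" by (intro holomorphic_intros holF)
    have dP: "deriv (\<lambda>w. F n w - b) w = deriv (F n) w" if "w \<in> ball z e" for w
      using holF that by (subst deriv_diff) (auto intro: holomorphic_on_imp_differentiable_at[of _ "ball z e"])
    have zer: "deriv (F n) w - \<epsilon> n = 0 \<and> deriv (\<lambda>w. F n w - b) w \<noteq> 0"
      if w: "w \<in> ball z e" "F n w - b = 0" for w
      using share[of w n] dP[OF w(1)] \<epsilon>(2) w by simp
    have "\<exists>Q. Q holomorphic_on ball z e \<and> (\<forall>w\<in>ball z e. deriv (F n) w - \<epsilon> n = Q w * (F n w - b))"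
      using holomorphic_quotient_at_simple_zeros[OF open_ball hN hP zer] by metis
    then obtain Q where Q: "Q holomorphic_on ball z e"
        "\<And>w. w \<in> ball z e \<Longrightarrow> deriv (F n) w - \<epsilon> n = Q w * (F n w - b)" by blast
    have QM: "norm (Q w) \<le> M" if w: "w \<in> cball z s" for w
    proof (rule maximum_modulus_frontier[where f = Q and S = "cball z s" and B = M and \<xi> = w])
      show "Q holomorphic_on interior (cball z s)"
        by (rule holomorphic_on_subset[OF Q(1) subset_trans[OF interior_subset cb(2)]])
      show "continuous_on (closure (cball z s)) Q"
        using holomorphic_on_imp_continuous_on[OF holomorphic_on_subset[OF Q(1) cb(2)]] by simp
      show "bounded (cball z s)" by simp
      show "w \<in> cball z s" by (rule w)
      fix v assume "v \<in> frontier (cball z s)"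
      then have v: "v \<in> sphere z s" by simp
      then have v': "v \<in> cball z s" by auto
      have "m / 2 \<le> norm (F n v - b)"
      proof -
        have "dist (F n v) (G v) < m/2" using elim(1) v' cb by blast
        then have "norm (F n v - G v) < m/2" by (simp add: dist_norm)
        moreover have "norm (G v - b) \<le> norm (F n v - b) + norm (F n v - G v)"
          using norm_triangle_ineq4[of "F n v - b" "F n v - G v"] by simp
        ultimately show ?thesis using m(2)[OF v] by linarith
      qed
      moreover have "norm (deriv (F n) v - \<epsilon> n) \<le> B + 2"
      proof -
        have "dist (deriv (F n) v) (deriv G v) < 1" using elim(2) v' cb by blast
        then have "norm (deriv (F n) v - deriv G v) < 1" by (simp add: dist_norm)
        moreover have "norm (deriv (F n) v) \<le> norm (deriv G v) + norm (deriv (F n) v - deriv G v)"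
          by (rule norm_triangle_sub)
        moreover have "norm (deriv (F n) v - \<epsilon> n) \<le> norm (deriv (F n) v) + norm (\<epsilon> n)"
          by (rule norm_triangle_ineq4)
        ultimately show ?thesis using B[OF v'] elim(3) by simp
      qed
      moreover have "norm (deriv (F n) v - \<epsilon> n) = norm (Q v) * norm (F n v - b)"
        using Q(2)[of v] v' cb by (metis norm_mult subsetD)
      ultimately have "norm (Q v) * (m/2) \<le> B + 2"
        using mult_left_mono[of "m/2" "norm (F n v - b)" "norm (Q v)"] by simp
      then show "norm (Q v) \<le> M" using m by (simp add: M_def field_simps)
    qed
    show ?case
    proof
      fix w assume w: "w \<in> cball z s"
      then have "norm (deriv (F n) w - \<epsilon> n) = norm (Q w) * norm (F n w - b)"
        using Q(2)[of w] cb by (metis norm_mult subsetD)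
      then show "norm (deriv (F n) w - \<epsilon> n) \<le> M * norm (F n w - b)"
        using QM[OF w] by (simp add: mult_right_mono)
    qed
  qed
  have bound: "norm (deriv G w) \<le> M * norm (G w - b)" if w: "w \<in> ball z s" for w
  proof -
    have we: "w \<in> ball z e" using w s e by auto
    have 1: "(\<lambda>n. deriv (F n) w) \<longlonglongrightarrow> deriv G w"
      by (rule deriv_complex_uniform_limit[OF lim]) (use holF we in auto)
    have 2: "(\<lambda>n. F n w) \<longlonglongrightarrow> G w" by (rule tendsto_uniform_limitI[OF lim we])
    have 3: "(\<lambda>n. norm (deriv (F n) w - \<epsilon> n)) \<longlonglongrightarrow> norm (deriv G w - 0)"
      by (intro tendsto_intros 1 \<epsilon>)
    have 4: "(\<lambda>n. M * norm (F n w - b)) \<longlonglongrightarrow> M * norm (G w - b)" by (intro tendsto_intros 2)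
    have "norm (deriv G w - 0) \<le> M * norm (G w - b)"
      by (rule tendsto_le[OF _ 4 3]) (use key w in \<open>auto elim: eventually_mono\<close>)
    then show ?thesis by simp
  qed
  obtain j where j: "k = Suc j" using k by (cases k) auto
  \<comment> \<open>The bound on \<open>deriv G\<close>, divided by the common factor \<open>(w - z)\<close> to the power \<open>k - 1\<close>.\<close>
  have ineq: "norm (of_nat k * g w + (w - z) * deriv g w) \<le> M * (norm (w - z) * norm (g w))"
    if w: "w \<in> ball z s" "w \<noteq> z" for w
  proof -
    have wr: "w \<in> ball z r" using w s by auto
    have dg: "(g has_field_derivative deriv g w) (at w)" using g(1) wr holomorphic_derivI by blast
    have "((\<lambda>w. (w - z) ^ k * g w + b) has_field_derivative
        (of_nat k * (w - z) ^ j * g w + (w - z) ^ k * deriv g w)) (at w)"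
      by (rule derivative_eq_intros dg refl | simp add: j)+
    moreover have "\<forall>\<^sub>F w in nhds w. (w - z) ^ k * g w + b = G w"
      by (rule eventually_mono[OF eventually_nhds_in_open[of "ball z r" w]]) (use wr g(2) in \<open>auto simp: algebra_simps\<close>)
    ultimately have "(G has_field_derivative (of_nat k * (w - z) ^ j * g w + (w - z) ^ k * deriv g w)) (at w)"
      using DERIV_cong_ev[OF refl _ refl, of "\<lambda>w. (w - z) ^ k * g w + b" G w] by simp
    then have "deriv G w = (w - z) ^ j * (of_nat k * g w + (w - z) * deriv g w)"
      by (simp add: DERIV_imp_deriv j algebra_simps)
    then have "norm (w - z) ^ j * norm (of_nat k * g w + (w - z) * deriv g w) \<le> norm (w - z) ^ j * (M * (norm (w - z) * norm (g w)))"
      using bound[OF w(1)] g(2)[OF wr] by (simp add: norm_mult norm_power j mult_ac)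
    then show ?thesis using w by (simp add: mult_le_cancel_left)
  qed
  have zr: "z \<in> ball z r" using r by simp
  have c1: "isCont g z" "isCont (deriv g) z"
    using g(1) holomorphic_deriv[OF g(1)] zr
    by (meson continuous_on_eq_continuous_at holomorphic_on_imp_continuous_on open_ball)+
  have l1: "((\<lambda>w. norm (of_nat k * g w + (w - z) * deriv g w)) \<longlongrightarrow> norm (of_nat k * g z + (z - z) * deriv g z)) (at z)"
    using c1 unfolding isCont_def by (intro tendsto_intros)
  have l2: "((\<lambda>w. M * (norm (w - z) * norm (g w))) \<longlongrightarrow> M * (norm (z - z) * norm (g z))) (at z)"
    using c1 unfolding isCont_def by (intro tendsto_intros)
  have "\<forall>\<^sub>F w in at z. w \<in> ball z s - {z}" by (rule eventually_at_in_open) (use s in auto)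
  then have "norm (of_nat k * g z + (z - z) * deriv g z) \<le> M * (norm (z - z) * norm (g z))"
    by (intro tendsto_le[OF _ l2 l1]) (use ineq in \<open>auto elim: eventually_mono\<close>)
  then show False using g(3)[OF zr] k by simp
qed

text \<open>
  If \<open>deriv G z \<noteq> 0\<close>, then \<open>deriv (F n)\<close> is bounded away from 0 near \<open>z\<close> for large \<open>n\<close>, so that
  \<open>F n\<close> does not take the value \<open>a\<close> there; by Hurwitz's theorem neither does \<open>G\<close>.
\<close>

lemma Hurwitz_ramified_value:
  fixes F :: "nat \<Rightarrow> complex \<Rightarrow> complex"
  assumes e: "e > 0" and holF: "\<And>n. F n holomorphic_on ball z e"
    and holG: "G holomorphic_on ball z e"
    and lim: "uniform_limit (ball z e) F G sequentially"
    and \<eta>: "\<eta> \<longlonglongrightarrow> (0::real)"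
    and share: "\<And>n w. \<lbrakk>w \<in> ball z e; F n w = a\<rbrakk> \<Longrightarrow> norm (deriv (F n) w) \<le> \<eta> n"
    and nonconst: "\<not> G constant_on ball z e"
    and Ga: "G z = a"
  shows "deriv G z = 0"
proof (rule ccontr)
  assume nz: "deriv G z \<noteq> 0"
  define m where "m = norm (deriv G z) / 3"
  have m: "m > 0" using nz by (simp add: m_def)
  have "isCont (deriv G) z" using holomorphic_deriv[OF holG] e
    by (meson centre_in_ball continuous_on_eq_continuous_at holomorphic_on_imp_continuous_on open_ball)
  then have "\<forall>\<^sub>F w in nhds z. dist (deriv G w) (deriv G z) < m"
    using m by (auto simp: continuous_at_eps_delta eventually_nhds_metric)
  then obtain s0 where s0: "s0 > 0" "\<And>w. dist w z < s0 \<Longrightarrow> dist (deriv G w) (deriv G z) < m"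
    unfolding eventually_nhds_metric by blast
  define s where "s = min s0 (e/2)"
  have s: "s > 0" "ball z s \<subseteq> ball z e" "ball z s \<subseteq> ball z (e/2)" using s0 e by (auto simp: s_def)
  have Gm: "2 * m \<le> norm (deriv G w)" if "w \<in> ball z s" for w
  proof -
    have "dist (deriv G w) (deriv G z) < m" using s0(2)[of w] that by (auto simp: s_def dist_commute)
    then have "norm (deriv G z - deriv G w) < m" by (simp add: dist_norm norm_minus_commute)
    moreover have "norm (deriv G z) \<le> norm (deriv G w) + norm (deriv G z - deriv G w)" by (rule norm_triangle_sub)
    ultimately show ?thesis by (simp add: m_def)
  qed
  have "\<forall>\<^sub>F n in sequentially. \<forall>w\<in>ball z (e/2). dist (deriv (F n) w) (deriv G w) < m"
    using uniform_limitD[OF uniform_limit_deriv[OF e holF holG lim] m] .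
  moreover have "\<forall>\<^sub>F n in sequentially. \<eta> n < m" using \<eta> m order_tendstoD(2) by blast
  ultimately have "\<forall>\<^sub>F n in sequentially. \<forall>w\<in>ball z s. F n w \<noteq> a"
  proof (eventually_elim, intro ballI notI)
    fix n w assume n: "\<forall>w\<in>ball z (e/2). dist (deriv (F n) w) (deriv G w) < m" "\<eta> n < m"
      and w: "w \<in> ball z s" "F n w = a"
    have "norm (deriv (F n) w) \<le> \<eta> n" using share w s by blast
    moreover have "norm (deriv G w - deriv (F n) w) < m" proof -
      have "dist (deriv (F n) w) (deriv G w) < m" using n(1) w(1) s(3) by blast
      then show ?thesis by (simp add: dist_norm norm_minus_commute)
    qed
    moreover have "norm (deriv G w) \<le> norm (deriv (F n) w) + norm (deriv G w - deriv (F n) w)" by (rule norm_triangle_sub)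
    ultimately show False using Gm[OF w(1)] n(2) by linarith
  qed
  then obtain N where N: "\<And>n w. \<lbrakk>n \<ge> N; w \<in> ball z s\<rbrakk> \<Longrightarrow> F n w \<noteq> a"
    unfolding eventually_sequentially by blast
  have "(\<lambda>w. G w - a) z \<noteq> 0"
  proof (rule Hurwitz_no_zeros[of "ball z s" "\<lambda>n w. F (n + N) w - a" "\<lambda>w. G w - a"])
    show "\<And>n. (\<lambda>w. F (n + N) w - a) holomorphic_on ball z s" "(\<lambda>w. G w - a) holomorphic_on ball z s"
      by (intro holomorphic_intros holomorphic_on_subset[OF holF] holomorphic_on_subset[OF holG] s)+
    show "uniform_limit K (\<lambda>n w. F (n + N) w - a) (\<lambda>w. G w - a) sequentially" if "K \<subseteq> ball z s" for K
    proof -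
      have "uniform_limit K F G sequentially" using uniform_limit_on_subset[OF lim] that s by blast
      then have "uniform_limit K (\<lambda>n. F (n + N)) G sequentially"
        by (rule filterlim_compose) (rule filterlim_add_const_nat_at_top)
      then show ?thesis by (intro uniform_limit_intros)
    qed
    show "\<not> (\<lambda>w. G w - a) constant_on ball z s"
    proof
      assume "(\<lambda>w. G w - a) constant_on ball z s"
      then obtain y where "\<forall>w\<in>ball z s. G w - a = y" unfolding constant_on_def by blast
      moreover have "z \<in> ball z s" using s by simp
      ultimately have "\<forall>w\<in>ball z s. G w - a = G z - a" by metis
      then have c: "G w = G z" if "w \<in> ball z s" for w using that by (metis diff_add_cancel)
      have "\<forall>\<^sub>F w in nhds z. w \<in> ball z s" by (rule eventually_nhds_in_open) (use s(1) in auto)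
      then have "\<forall>\<^sub>F w in nhds z. G w = G z" by (rule eventually_mono) (rule c)
      then have "(G has_field_derivative 0) (at z)"
        using DERIV_cong_ev[OF refl _ refl, of G "\<lambda>_. G z" z 0] by simp
      then show False using nz DERIV_imp_deriv by blast
    qed
  qed (use N s in auto)
  then show False using Ga by simp
qed

section \<open>Holomorphic maps into the sphere\<close>

text \<open>
  The two standard charts of the sphere: \<open>chart True\<close> is centred at 0 and \<open>chart False\<close> at infinity.
\<close>

definition chart :: "bool \<Rightarrow> complex \<Rightarrow> riemann_sphere" where
  "chart s w = (if s then Some w else if w = 0 then None else Some (inverse w))"

definition finite_value :: "riemann_sphere \<Rightarrow> complex" where
  "finite_value p = (case p of None \<Rightarrow> 0 | Some w \<Rightarrow> w)"

lemma finite_value_chart [simp]: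
  "finite_value (Some w) = w" "finite_value None = 0"
  "finite_value (chart True w) = w" "finite_value (chart False w) = inverse w"
  by (auto simp: finite_value_def chart_def)

lemma chart_True [simp]: "chart True w = Some w" by (simp add: chart_def)

lemma chart_eq_None [simp]: "chart s w = None \<longleftrightarrow> \<not> s \<and> w = 0" by (simp add: chart_def)

definition sphere_holomorphic_at :: "(complex \<Rightarrow> riemann_sphere) \<Rightarrow> complex \<Rightarrow> bool" where
  "sphere_holomorphic_at \<phi> z \<longleftrightarrow>
     (\<exists>s F e. 0 < e \<and> F holomorphic_on ball z e \<and> (\<forall>w\<in>ball z e. \<phi> w = chart s (F w)))"

text \<open>
  At a point where \<open>\<phi>\<close> is infinite the formula \<open>|F'| / (1 + |F|\<^sup>2)\<close> is read in the chart at infinity,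
  where \<open>F\<close> vanishes. The convention \<open>inverse 0 = 0\<close> makes \<open>inverse (finite_value (\<phi> w))\<close> the
  coordinate in that chart at every \<open>w\<close> with \<open>\<phi> w \<noteq> Some 0\<close>, including the poles.
\<close>

definition spherical_deriv :: "(complex \<Rightarrow> riemann_sphere) \<Rightarrow> complex \<Rightarrow> real" where
  "spherical_deriv \<phi> z =
     (if \<phi> z = None then norm (deriv (\<lambda>w. inverse (finite_value (\<phi> w))) z)
      else norm (deriv (\<lambda>w. finite_value (\<phi> w)) z) / (1 + (norm (finite_value (\<phi> z)))\<^sup>2))"

lemma deriv_cong_open:
  assumes "open S" "z \<in> S" "\<And>w. w \<in> S \<Longrightarrow> f w = g w"
  shows "deriv f z = deriv g z"
  using eventually_nhds_in_open[OF assms(1,2)]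
  by (intro deriv_cong_ev refl) (auto elim!: eventually_mono simp: assms(3))

text \<open>
  The spherical derivative is invariant under inversion, so it can be computed in either chart.
\<close>

lemma spherical_deriv_chart:
  assumes S: "open S" "z \<in> S" and F: "F holomorphic_on S" and \<phi>: "\<And>w. w \<in> S \<Longrightarrow> \<phi> w = chart s (F w)"
  shows "spherical_deriv \<phi> z = norm (deriv F z) / (1 + (norm (F z))\<^sup>2)"
proof (cases s)
  case True
  have "deriv (\<lambda>w. finite_value (\<phi> w)) z = deriv F z"
    by (rule deriv_cong_open[OF S]) (simp add: \<phi> True)
  then show ?thesis using True \<phi>[OF S(2)] by (simp add: spherical_deriv_def)
next
  case False
  show ?thesis
  proof (cases "F z = 0")
    case True
    have "deriv (\<lambda>w. inverse (finite_value (\<phi> w))) z = deriv F z"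
      by (rule deriv_cong_open[OF S]) (simp add: \<phi> False)
    then show ?thesis using True False \<phi>[OF S(2)] by (simp add: spherical_deriv_def)
  next
    case nz: False
    have "deriv (\<lambda>w. finite_value (\<phi> w)) z = deriv (\<lambda>w. inverse (F w)) z"
      by (rule deriv_cong_open[OF S]) (simp add: \<phi> False)
    also have "(F has_field_derivative deriv F z) (at z)" using F S holomorphic_derivI by blast
    then have "deriv (\<lambda>w. inverse (F w)) z = - (inverse (F z) * deriv F z * inverse (F z))"
      using nz DERIV_imp_deriv DERIV_inverse' by blast
    finally have d: "norm (deriv (\<lambda>w. finite_value (\<phi> w)) z) = norm (deriv F z) / (norm (F z))\<^sup>2"
      by (simp add: norm_mult norm_inverse power2_eq_square divide_inverse)
    have "norm (F z) > 0" using nz by simp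
    then have "norm (deriv F z) / (norm (F z))\<^sup>2 / (1 + (inverse (norm (F z)))\<^sup>2) = norm (deriv F z) / (1 + (norm (F z))\<^sup>2)"
      by (simp add: divide_simps power_inverse add.commute)
    then show ?thesis using nz False \<phi>[OF S(2)] d by (simp add: spherical_deriv_def norm_inverse)
  qed
qed

lemma spherical_deriv_nonneg: "0 \<le> spherical_deriv \<phi> z"
  by (simp add: spherical_deriv_def)

lemma continuous_on_spherical_deriv:
  assumes "\<And>z. z \<in> S \<Longrightarrow> sphere_holomorphic_at \<phi> z"
  shows "continuous_on S (spherical_deriv \<phi>)"
proof (rule continuous_at_imp_continuous_on, rule ballI)
  fix z assume "z \<in> S"
  then obtain s F e where e: "0 < e" "F holomorphic_on ball z e" "\<And>w. w \<in> ball z e \<Longrightarrow> \<phi> w = chart s (F w)"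
    using assms unfolding sphere_holomorphic_at_def by blast
  have "continuous_on (ball z e) (\<lambda>w. norm (deriv F w) / (1 + (norm (F w))\<^sup>2))"
    by (intro continuous_intros holomorphic_on_imp_continuous_on holomorphic_deriv e)
       (auto intro!: e simp: add_nonneg_eq_0_iff)
  then have "continuous_on (ball z e) (spherical_deriv \<phi>)"
    by (rule continuous_on_eq) (use spherical_deriv_chart[OF open_ball _ e(2,3)] in auto)
  then show "isCont (spherical_deriv \<phi>) z"
    using e(1) by (simp add: continuous_on_eq_continuous_at)
qed

lemma affine_sphere_holomorphic:
  assumes "sphere_holomorphic_at \<phi> (z0 + of_real \<rho> * z)" and "\<rho> > 0"
  shows "sphere_holomorphic_at (\<lambda>w. \<phi> (z0 + of_real \<rho> * w)) z"
    and "spherical_deriv (\<lambda>w. \<phi> (z0 + of_real \<rho> * w)) z = \<rho> * spherical_deriv \<phi> (z0 + of_real \<rho> * z)"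
proof -
  define z1 where "z1 = z0 + of_real \<rho> * z"
  obtain s F e where e: "0 < e" "F holomorphic_on ball z1 e" "\<And>w. w \<in> ball z1 e \<Longrightarrow> \<phi> w = chart s (F w)"
    using assms(1) unfolding sphere_holomorphic_at_def z1_def by blast
  define f where "f w = F (z0 + of_real \<rho> * w)" for w
  have inb: "z0 + of_real \<rho> * w \<in> ball z1 e" if "w \<in> ball z (e / \<rho>)" for w
  proof -
    have "dist z1 (z0 + of_real \<rho> * w) = \<rho> * dist z w"
      using assms(2) by (simp add: z1_def dist_norm norm_mult flip: right_diff_distrib)
    then show ?thesis using that assms(2) by (simp add: pos_less_divide_eq mult.commute)
  qed
  have e': "e / \<rho> > 0" using e assms by simp
  have f: "f holomorphic_on ball z (e / \<rho>)" unfolding f_def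
    by (rule holomorphic_on_compose_gen[OF _ e(2), unfolded o_def]) (use inb in \<open>auto intro!: holomorphic_intros\<close>)
  have ch: "\<phi> (z0 + of_real \<rho> * w) = chart s (f w)" if "w \<in> ball z (e / \<rho>)" for w
    using e(3)[OF inb[OF that]] by (simp add: f_def)
  show "sphere_holomorphic_at (\<lambda>w. \<phi> (z0 + of_real \<rho> * w)) z"
    unfolding sphere_holomorphic_at_def using e' f ch by blast
  have "(F has_field_derivative deriv F z1) (at z1)" using e holomorphic_derivI by (metis centre_in_ball open_ball)
  then have "(f has_field_derivative deriv F z1 * of_real \<rho>) (at z)" unfolding f_def z1_def
    by (rule DERIV_chain2) (rule derivative_eq_intros refl | simp)+
  then have "deriv f z = deriv F z1 * of_real \<rho>" by (rule DERIV_imp_deriv)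
  moreover have "spherical_deriv (\<lambda>w. \<phi> (z0 + of_real \<rho> * w)) z = norm (deriv f z) / (1 + (norm (f z))\<^sup>2)"
    by (rule spherical_deriv_chart[OF open_ball _ f ch]) (use e' in auto)
  moreover have "spherical_deriv \<phi> z1 = norm (deriv F z1) / (1 + (norm (F z1))\<^sup>2)"
    by (rule spherical_deriv_chart[OF open_ball _ e(2,3)]) (use e in auto)
  ultimately show "spherical_deriv (\<lambda>w. \<phi> (z0 + of_real \<rho> * w)) z = \<rho> * spherical_deriv \<phi> (z0 + of_real \<rho> * z)"
    using assms(2) by (simp add: norm_mult z1_def f_def)
qed

text \<open>
  The vertical coordinate on the unit sphere. It decides which chart has a coordinate bounded by 2, and
  being a real function it gives a Lipschitz estimate that does not refer to a chart.
\<close>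

definition height :: "riemann_sphere \<Rightarrow> real" where "height p = snd (sphere_point p)"

lemma height_chart: "height (chart s w) = (if s then 1 else - 1) * (1 - 2 / (1 + (norm w)\<^sup>2))"
proof -
  define Y where "Y = (norm w)\<^sup>2"
  have Y: "Y \<ge> 0" by (simp add: Y_def)
  then have 1: "(Y - 1) / (1 + Y) = 1 - 2 / (1 + Y)" by (simp add: field_simps)
  have 2: "(inverse Y - 1) / (1 + inverse Y) = - (1 - 2 / (1 + Y))" if "Y > 0"
  proof -
    have "inverse Y - 1 = (1 - Y) / Y" "1 + inverse Y = (1 + Y) / Y" using that by (simp_all add: field_simps)
    then have "(inverse Y - 1) / (1 + inverse Y) = (1 - Y) / (1 + Y)" using that by simp
    then show ?thesis using that by (simp add: field_simps)
  qed
  show ?thesis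
  proof (cases "w = 0")
    case True
    then show ?thesis by (auto simp: height_def sphere_point_def chart_def)
  next
    case False
    then have "Y > 0" by (simp add: Y_def)
    then show ?thesis using 1 2 False
      by (auto simp: height_def sphere_point_def chart_def norm_inverse power_inverse simp flip: Y_def)
  qed
qed

text \<open>
  In a chart the height is \<open>\<plusminus>(1 - 2 / (1 + |F|\<^sup>2))\<close>, whose derivative is bounded by
  \<open>4 |F| |F'| / (1 + |F|\<^sup>2)\<^sup>2\<close>, and \<open>2 |F| \<le> 1 + |F|\<^sup>2\<close>.
\<close>

lemma height_Lipschitz:
  assumes hol: "\<And>w. w \<in> ball z e \<Longrightarrow> sphere_holomorphic_at \<phi> w"
    and B: "\<And>w. w \<in> ball z e \<Longrightarrow> spherical_deriv \<phi> w \<le> B"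
    and w: "w \<in> ball z e"
  shows "\<bar>height (\<phi> w) - height (\<phi> z)\<bar> \<le> 2 * B * dist w z"
proof -
  have "\<exists>D. ((\<lambda>w. height (\<phi> w)) has_derivative D) (at x) \<and> onorm D \<le> 2 * B" if x: "x \<in> ball z e" for x
  proof -
    obtain s F r where r: "0 < r" "F holomorphic_on ball x r" "\<And>w. w \<in> ball x r \<Longrightarrow> \<phi> w = chart s (F w)"
      using hol[OF x] unfolding sphere_holomorphic_at_def by blast
    define c :: real where "c = (if s then 1 else - 1)"
    have "(F has_field_derivative deriv F x) (at x)"
      using r holomorphic_derivI by (metis centre_in_ball open_ball)
    then have dF: "(F has_derivative (\<lambda>h. deriv F x * h)) (at x)" by (simp add: has_field_derivative_def)
    define Q where "Q = 1 + (norm (F x))\<^sup>2"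
    have Q: "Q > 0" "Q = 1 + F x \<bullet> F x" by (simp_all add: Q_def add_pos_nonneg power2_norm_eq_inner)
    define D where "D h = c * (4 * (F x \<bullet> (deriv F x * h)) / Q\<^sup>2)" for h
    have "((\<lambda>w. c * (1 - 2 / (1 + F w \<bullet> F w))) has_derivative D) (at x)"
      unfolding D_def using Q
      by (auto intro!: derivative_eq_intros dF simp: inner_commute power2_eq_square field_simps)
    moreover have "\<forall>\<^sub>F w in nhds x. c * (1 - 2 / (1 + F w \<bullet> F w)) = height (\<phi> w)"
    proof -
      have "\<forall>\<^sub>F w in nhds x. w \<in> ball x r" by (rule eventually_nhds_in_open) (use r in auto)
      then show ?thesis by eventually_elim (simp add: r height_chart c_def power2_norm_eq_inner)
    qed
    ultimately have "((\<lambda>w. height (\<phi> w)) has_derivative D) (at x)"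
      using has_derivative_transform_eventually[of _ D x UNIV "\<lambda>w. height (\<phi> w)"]
      by (simp add: eventually_nhds_conv_at)
    moreover have "onorm D \<le> 2 * B"
    proof (rule onorm_le)
      fix h
      have "norm (D h) = 4 * \<bar>F x \<bullet> (deriv F x * h)\<bar> / Q\<^sup>2"
        by (simp add: D_def c_def abs_mult)
      also have "\<dots> \<le> 4 * (norm (F x) * norm (deriv F x * h)) / Q\<^sup>2"
        by (intro divide_right_mono mult_left_mono Cauchy_Schwarz_ineq2) auto
      also have "\<dots> = 2 * (2 * norm (F x)) * (norm (deriv F x) * norm h) / Q\<^sup>2" by (simp add: norm_mult)
      also have "\<dots> \<le> 2 * Q * (norm (deriv F x) * norm h) / Q\<^sup>2"
      proof -
        have "0 \<le> (1 - norm (F x))\<^sup>2" by simp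
        then have "2 * norm (F x) \<le> Q" by (simp add: Q_def power2_eq_square algebra_simps)
        then show ?thesis by (intro divide_right_mono mult_right_mono mult_left_mono) auto
      qed
      also have "\<dots> = 2 * (norm (deriv F x) / Q) * norm h" using Q(1) by (simp add: power2_eq_square)
      also have "norm (deriv F x) / Q = spherical_deriv \<phi> x"
        using spherical_deriv_chart[OF open_ball _ r(2,3), of x] r(1) by (simp add: Q_def)
      also have "2 * spherical_deriv \<phi> x * norm h \<le> 2 * B * norm h" using B[OF x] by (simp add: mult_right_mono)
      finally show "norm (D h) \<le> 2 * B * norm h" .
    qed
    ultimately show ?thesis by blast
  qed
  then obtain D where D: "\<And>x. x \<in> ball z e \<Longrightarrow> ((\<lambda>w. height (\<phi> w)) has_derivative D x) (at x)"
    "\<And>x. x \<in> ball z e \<Longrightarrow> onorm (D x) \<le> 2 * B" by metis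
  have z: "z \<in> ball z e" using w by (metis centre_in_ball dist_not_less_zero linorder_not_less mem_ball order_le_less_trans zero_le_dist)
  have "norm (height (\<phi> w) - height (\<phi> z)) \<le> 2 * B * norm (w - z)"
    by (rule differentiable_bound[OF convex_ball _ D(2) w z]) (use D(1) has_derivative_at_withinI in blast)
  then show ?thesis by (simp add: dist_norm)
qed

lemma finite_value_differentiable:
  assumes hol: "sphere_holomorphic_at \<phi> z" and fin: "\<forall>\<^sub>F w in nhds z. \<phi> w \<noteq> None"
  shows "(\<lambda>w. finite_value (\<phi> w)) field_differentiable at z"
proof -
  obtain s F e where e: "0 < e" "F holomorphic_on ball z e" "\<And>w. w \<in> ball z e \<Longrightarrow> \<phi> w = chart s (F w)"
    using hol unfolding sphere_holomorphic_at_def by blast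
  have ev: "\<forall>\<^sub>F w in nhds z. w \<in> ball z e" by (rule eventually_nhds_in_open) (use e in auto)
  have dF: "F field_differentiable at z" using e holomorphic_on_imp_differentiable_at by (metis centre_in_ball open_ball)
  define f where "f w = (if s then F w else inverse (F w))" for w
  have "f field_differentiable at z"
  proof (cases s)
    case True then show ?thesis using dF by (simp add: f_def[abs_def])
  next
    case False
    then have "F z \<noteq> 0" using eventually_nhds_x_imp_x[OF fin] e(1) e(3)[of z] by auto
    then show ?thesis using False dF by (simp add: f_def[abs_def] field_differentiable_inverse)
  qed
  then obtain l where l: "(f has_field_derivative l) (at z)" by (auto simp: field_differentiable_def)
  have "\<forall>\<^sub>F w in nhds z. f w = finite_value (\<phi> w)"
    using ev by eventually_elim (auto simp: f_def e(3))
  then have "((\<lambda>w. finite_value (\<phi> w)) has_field_derivative l) (at z)"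
    using DERIV_cong_ev[OF refl _ refl, of f "\<lambda>w. finite_value (\<phi> w)" z l] l by simp
  then show ?thesis by (auto simp: field_differentiable_def)
qed

lemma inverse_finite_value_differentiable:
  assumes hol: "sphere_holomorphic_at \<phi> z" and fin: "\<forall>\<^sub>F w in nhds z. \<phi> w \<noteq> Some 0"
  shows "(\<lambda>w. inverse (finite_value (\<phi> w))) field_differentiable at z"
proof -
  obtain s F e where e: "0 < e" "F holomorphic_on ball z e" "\<And>w. w \<in> ball z e \<Longrightarrow> \<phi> w = chart s (F w)"
    using hol unfolding sphere_holomorphic_at_def by blast
  have ev: "\<forall>\<^sub>F w in nhds z. w \<in> ball z e" by (rule eventually_nhds_in_open) (use e in auto)
  have dF: "F field_differentiable at z" using e holomorphic_on_imp_differentiable_at by (metis centre_in_ball open_ball)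
  define f where "f w = (if s then inverse (F w) else F w)" for w
  have "f field_differentiable at z"
  proof (cases s)
    case False then show ?thesis using dF by (simp add: f_def[abs_def])
  next
    case True
    then have "F z \<noteq> 0" using eventually_nhds_x_imp_x[OF fin] e(1) e(3)[of z] by auto
    then show ?thesis using True dF by (simp add: f_def[abs_def] field_differentiable_inverse)
  qed
  then obtain l where l: "(f has_field_derivative l) (at z)" by (auto simp: field_differentiable_def)
  have "\<forall>\<^sub>F w in nhds z. f w = inverse (finite_value (\<phi> w))"
    using ev by eventually_elim (auto simp: f_def e(3))
  then have "((\<lambda>w. inverse (finite_value (\<phi> w))) has_field_derivative l) (at z)"
    using DERIV_cong_ev[OF refl _ refl, of f "\<lambda>w. inverse (finite_value (\<phi> w))" z l] l by simp
  then show ?thesis by (auto simp: field_differentiable_def)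
qed

text \<open>
  On a ball of radius at most \<open>1 / 4B\<close> the height varies by less than \<open>1/2\<close>. If it is at most 0 at the
  centre, it stays below \<open>1/2\<close>, which means \<open>|F|\<^sup>2 < 3\<close> in the chart at 0; the other case is symmetric.
  Hence one chart with bounded coordinate serves the whole ball.
\<close>

lemma bounded_chart_on_ball:
  assumes hol: "\<And>w. w \<in> ball z e \<Longrightarrow> sphere_holomorphic_at \<phi> w"
    and B: "\<And>w. w \<in> ball z e \<Longrightarrow> spherical_deriv \<phi> w \<le> B" and e: "0 < e" "e * B \<le> 1 / 4" "B > 0"
    and s: "s \<longleftrightarrow> height (\<phi> z) \<le> 0"
  obtains F where "F holomorphic_on ball z e" "\<And>w. w \<in> ball z e \<Longrightarrow> \<phi> w = chart s (F w) \<and> norm (F w) \<le> 2"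
proof -
  have ht: "\<bar>height (\<phi> w) - height (\<phi> z)\<bar> < 1 / 2" if "w \<in> ball z e" for w
  proof -
    have "\<bar>height (\<phi> w) - height (\<phi> z)\<bar> \<le> 2 * B * dist w z" by (rule height_Lipschitz[OF hol B that])
    also have "\<dots> < 2 * B * e" using that e by (simp add: dist_commute)
    also have "\<dots> \<le> 1 / 2" using e by (simp add: mult.commute)
    finally show ?thesis .
  qed
  define F where "F w = (if s then finite_value (\<phi> w) else inverse (finite_value (\<phi> w)))" for w
  have small: "norm w \<le> 2" if "1 - 2 / (1 + (norm w)\<^sup>2) < 1 / 2" for w :: complex
  proof -
    have p: "1 + (norm w)\<^sup>2 > 0" by (simp add: add_pos_nonneg)
    then have "(norm w)\<^sup>2 < 3" using that by (simp add: field_simps)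
    then have "(norm w)\<^sup>2 \<le> 2\<^sup>2" by simp
    then show ?thesis by (rule power2_le_imp_le) simp
  qed
  have ev: "\<forall>\<^sub>F v in nhds w. v \<in> ball z e" if "w \<in> ball z e" for w
    by (rule eventually_nhds_in_open) (use that in auto)
  have h0: "height None = 1" "height (Some 0) = -1" by (simp_all add: height_def sphere_point_def)
  show ?thesis
  proof (cases s)
    case True
    have lt: "height (\<phi> w) < 1/2" if "w \<in> ball z e" for w using ht[OF that] s True by linarith
    have nN: "\<phi> w \<noteq> None" if "w \<in> ball z e" for w
    proof
      assume "\<phi> w = None" then show False using lt[OF that] h0 by simp
    qed
    have "F field_differentiable at w" if w: "w \<in> ball z e" for w
    proof -
      have "\<forall>\<^sub>F v in nhds w. \<phi> v \<noteq> None" using ev[OF w] nN by (auto elim: eventually_mono)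
      then show ?thesis using finite_value_differentiable[OF hol[OF w]] True by (simp add: F_def[abs_def])
    qed
    then have "F holomorphic_on ball z e" unfolding holomorphic_on_def using field_differentiable_at_within by blast
    moreover have "\<phi> w = chart s (F w) \<and> norm (F w) \<le> 2" if w: "w \<in> ball z e" for w
    proof -
      have 1: "\<phi> w = chart True (F w)" using nN[OF w] True by (auto simp: F_def)
      then have "1 - 2 / (1 + (norm (F w))\<^sup>2) < 1 / 2" using lt[OF w] height_chart[of True "F w"] by simp
      then show ?thesis using 1 small True by auto
    qed
    ultimately show ?thesis by (rule that)
  next
    case False
    have lt: "height (\<phi> w) > - 1/2" if "w \<in> ball z e" for w using ht[OF that] s False by linarith
    have nN: "\<phi> w \<noteq> Some 0" if "w \<in> ball z e" for w
    proof
      assume "\<phi> w = Some 0" then show False using lt[OF that] h0 by simp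
    qed
    have "F field_differentiable at w" if w: "w \<in> ball z e" for w
    proof -
      have "\<forall>\<^sub>F v in nhds w. \<phi> v \<noteq> Some 0" using ev[OF w] nN by (auto elim: eventually_mono)
      then show ?thesis using inverse_finite_value_differentiable[OF hol[OF w]] False by (simp add: F_def[abs_def])
    qed
    then have "F holomorphic_on ball z e" unfolding holomorphic_on_def using field_differentiable_at_within by blast
    moreover have "\<phi> w = chart s (F w) \<and> norm (F w) \<le> 2" if w: "w \<in> ball z e" for w
    proof -
      have 1: "\<phi> w = chart False (F w)" using nN[OF w] False by (cases "\<phi> w") (auto simp: F_def chart_def)
      then have "1 - 2 / (1 + (norm (F w))\<^sup>2) < 1 / 2" using lt[OF w] height_chart[of False "F w"] by simp
      then show ?thesis using 1 small False by auto
    qed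
    ultimately show ?thesis by (rule that)
  qed
qed

section \<open>Convergence in a chart and spherical convergence\<close>

text \<open>
  A form of spherically uniform convergence on \<open>U\<close> in which both the sequence and the limit are read in
  one chart and remain in the disc of radius 2. There the euclidean and the spherical metric are
  comparable, and theorems on uniform limits of holomorphic functions apply.
\<close>

definition chart_convergent_on ::
  "complex set \<Rightarrow> (nat \<Rightarrow> complex \<Rightarrow> riemann_sphere) \<Rightarrow> (complex \<Rightarrow> riemann_sphere) \<Rightarrow> bool" where
  "chart_convergent_on U \<phi> \<psi> \<longleftrightarrow>
     (\<exists>s F G. (\<forall>\<^sub>F n in sequentially. F n holomorphic_on U \<and> (\<forall>w\<in>U. \<phi> n w = chart s (F n w) \<and> norm (F n w) \<le> 2)) \<and>
        G holomorphic_on U \<and> (\<forall>w\<in>U. \<psi> w = chart s (G w) \<and> norm (G w) \<le> 2) \<and> uniform_limit U F G sequentially)"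

lemma chart_convergent_on_sphere_holomorphic:
  assumes "chart_convergent_on U \<phi> \<psi>" "open U" "z \<in> U"
  shows "sphere_holomorphic_at \<psi> z"
proof -
  obtain s G where G: "G holomorphic_on U" "\<forall>w\<in>U. \<psi> w = chart s (G w)"
    using assms(1) unfolding chart_convergent_on_def by blast
  obtain e where "e > 0" "ball z e \<subseteq> U" using assms open_contains_ball by blast
  then show ?thesis unfolding sphere_holomorphic_at_def
    using G holomorphic_on_subset[OF G(1)] by blast
qed

lemma chart_convergent_on_spherical_deriv:
  assumes conv: "chart_convergent_on U \<phi> \<psi>" and U: "open U" "z \<in> U"
  shows "(\<lambda>n. spherical_deriv (\<phi> n) z) \<longlonglongrightarrow> spherical_deriv \<psi> z"
proof -
  obtain s F G where
    F: "\<forall>\<^sub>F n in sequentially. F n holomorphic_on U \<and> (\<forall>w\<in>U. \<phi> n w = chart s (F n w) \<and> norm (F n w) \<le> 2)"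
    and G: "G holomorphic_on U" "\<forall>w\<in>U. \<psi> w = chart s (G w) \<and> norm (G w) \<le> 2"
    and lim: "uniform_limit U F G sequentially"
    using conv unfolding chart_convergent_on_def by blast
  have B: "spherical_deriv \<psi> z = norm (deriv G z) / (1 + (norm (G z))\<^sup>2)"
    by (rule spherical_deriv_chart[OF U G(1)]) (use G in auto)
  have "(\<lambda>n. deriv (F n) z) \<longlonglongrightarrow> deriv G z"
    by (rule deriv_complex_uniform_limit[OF lim _ _ U]) (use F in \<open>auto elim: eventually_mono\<close>)
  moreover have "(\<lambda>n. F n z) \<longlonglongrightarrow> G z" by (rule tendsto_uniform_limitI[OF lim U(2)])
  moreover have "1 + (norm (G z))\<^sup>2 \<noteq> 0" by (simp add: add_nonneg_eq_0_iff)
  ultimately have "(\<lambda>n. norm (deriv (F n) z) / (1 + (norm (F n z))\<^sup>2)) \<longlonglongrightarrow> norm (deriv G z) / (1 + (norm (G z))\<^sup>2)"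
    by (intro tendsto_intros)
  then have L: "(\<lambda>n. norm (deriv (F n) z) / (1 + (norm (F n z))\<^sup>2)) \<longlonglongrightarrow> spherical_deriv \<psi> z"
    unfolding B .
  have "\<forall>\<^sub>F n in sequentially. norm (deriv (F n) z) / (1 + (norm (F n z))\<^sup>2) = spherical_deriv (\<phi> n) z"
    using F
  proof eventually_elim
    case (elim n)
    show ?case by (rule spherical_deriv_chart[OF U, symmetric]) (use elim in auto)
  qed
  with L show ?thesis by (rule Lim_transform_eventually)
qed

text \<open>
  Inversion acts on the unit sphere as the linear isometry \<open>(x, h) \<mapsto> (cnj x, -h)\<close>.
\<close>

lemma sphere_point_chart:
  "sphere_point (chart s w) =
     (2 * (if s then w else cnj w) / of_real (1 + (norm w)\<^sup>2), (if s then 1 else - 1) * ((norm w)\<^sup>2 - 1) / (1 + (norm w)\<^sup>2))"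
proof (cases "s \<or> w = 0")
  case True
  then show ?thesis by (auto simp: sphere_point_def chart_def)
next
  case False
  then have w: "w \<noteq> 0" "\<not> s" by auto
  define Y where "Y = (norm w)\<^sup>2"
  have Y: "Y > 0" using w by (simp add: Y_def)
  have "of_real Y = w * cnj w" by (simp add: Y_def complex_norm_square flip: of_real_power)
  then have i: "inverse w = cnj w / of_real Y" using w by (simp add: field_simps)
  have n: "(norm (inverse w))\<^sup>2 = inverse Y" by (simp add: Y_def norm_inverse power_inverse)
  have j: "1 + inverse Y = (1 + Y) / Y" "inverse Y - 1 = (1 - Y) / Y" using Y by (simp_all add: field_simps)
  have "sphere_point (Some (inverse w)) = (2 * inverse w / of_real (1 + inverse Y), (inverse Y - 1) / (1 + inverse Y))"
    by (simp add: sphere_point_def n)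
  also have "2 * inverse w / of_real (1 + inverse Y) = 2 * cnj w / of_real (1 + Y)"
    using Y unfolding i j by (simp add: field_simps)
  also have "(inverse Y - 1) / (1 + inverse Y) = (1 - Y) / (1 + Y)" using Y unfolding j by simp
  finally show ?thesis using w by (simp add: chart_def Y_def minus_divide_left)
qed

lemma inner_sphere_point_chart:
  "sphere_point (chart s u) \<bullet> sphere_point (chart s v) = sphere_point (Some u) \<bullet> sphere_point (Some v)"
  unfolding sphere_point_chart chart_True[symmetric, of u] chart_True[symmetric, of v]
  by (auto simp: inner_prod_def inner_complex_def left_diff_distrib right_diff_distrib)

lemma norm_sphere_point: "norm (sphere_point p) = 1"
proof -
  have 1: "norm (sphere_point (chart s w)) = 1" for s w
  proof -
    define Y where "Y = (norm w)\<^sup>2"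
    have Y: "1 + Y > 0" by (simp add: Y_def add_pos_nonneg)
    have "(norm (sphere_point (chart s w)))\<^sup>2 = (norm (2 * (if s then w else cnj w) / of_real (1 + Y)))\<^sup>2 + ((Y - 1) / (1 + Y))\<^sup>2"
      by (auto simp: sphere_point_chart norm_Pair Y_def power2_eq_square)
    also have "(norm (2 * (if s then w else cnj w) / of_real (1 + Y)))\<^sup>2 = 4 * Y / (1 + Y)\<^sup>2"
    proof -
      have "norm (complex_of_real (1 + Y)) = 1 + Y" using Y by (simp only: norm_of_real)
      moreover have "(norm (2 * (if s then w else cnj w)))\<^sup>2 = 4 * Y" by (simp add: norm_mult power_mult_distrib Y_def)
      ultimately show ?thesis by (simp only: norm_divide power_divide)
    qed
    also have "4 * Y / (1 + Y)\<^sup>2 + ((Y - 1) / (1 + Y))\<^sup>2 = (4 * Y + (Y - 1)\<^sup>2) / (1 + Y)\<^sup>2"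
      by (simp add: power_divide add_divide_distrib)
    also have "4 * Y + (Y - 1)\<^sup>2 = (1 + Y)\<^sup>2" by (simp add: power2_eq_square algebra_simps)
    finally have "(norm (sphere_point (chart s w)))\<^sup>2 = 1" using Y by simp
    then show ?thesis by (metis abs_norm_cancel abs_square_eq_1)
  qed
  have "p = chart (p \<noteq> None) (finite_value p)" by (cases p) (auto simp: chart_def)
  then show ?thesis by (metis 1)
qed

lemma spherical_dist_chart:
  "spherical_dist (chart s u) (chart s v) = spherical_dist (Some u) (Some v)"
  by (simp add: spherical_dist_def inner_sphere_point_chart)

lemma inner_sphere_point_le: "\<bar>sphere_point p \<bullet> sphere_point q\<bar> \<le> 1"
  using Cauchy_Schwarz_ineq2[of "sphere_point p" "sphere_point q"] by (simp add: norm_sphere_point)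

lemma continuous_on_spherical_dist:
  "continuous_on UNIV (\<lambda>(u, v). spherical_dist (Some u) (Some v))"
proof -
  have nz: "1 + (norm w)\<^sup>2 \<noteq> 0" for w :: complex by (simp add: add_nonneg_eq_0_iff)
  have nz': "1 + (complex_of_real (norm w))\<^sup>2 \<noteq> 0" for w :: complex
    using nz[of w] by (metis of_real_1 of_real_add of_real_eq_0_iff of_real_power)
  have sp: "continuous_on UNIV (\<lambda>w. sphere_point (Some w))"
    unfolding sphere_point_def by (auto intro!: continuous_intros simp: nz nz')
  have "continuous_on UNIV (\<lambda>p::complex \<times> complex. arccos (sphere_point (Some (fst p)) \<bullet> sphere_point (Some (snd p))))"
  proof (rule continuous_on_arccos)
    show "continuous_on UNIV (\<lambda>p::complex \<times> complex. sphere_point (Some (fst p)) \<bullet> sphere_point (Some (snd p)))"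
      by (intro continuous_on_inner continuous_on_compose2[OF sp] continuous_intros) auto
    show "\<forall>p\<in>UNIV. -1 \<le> sphere_point (Some (fst p)) \<bullet> sphere_point (Some (snd p)) \<and> sphere_point (Some (fst p)) \<bullet> sphere_point (Some (snd p)) \<le> 1"
      using inner_sphere_point_le by (auto simp: abs_le_iff)
  qed
  then show ?thesis by (simp add: spherical_dist_def case_prod_unfold)
qed

lemma spherical_dist_refl: "spherical_dist p p = 0"
  using norm_sphere_point[of p] by (simp add: spherical_dist_def dot_square_norm)

text \<open>
  Uniform continuity of the spherical distance, as a function of two points in a compact disc, together
  with its vanishing on the diagonal.
\<close>

lemma spherical_dist_small:
  assumes "\<epsilon> > 0"
  obtains \<delta> where "\<delta> > 0" "\<And>u v. \<lbrakk>norm u \<le> r; norm v \<le> r; dist u v < \<delta>\<rbrakk> \<Longrightarrow> spherical_dist (Some u) (Some v) < \<epsilon>"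
proof -
  have "compact (cball (0::complex) r \<times> cball (0::complex) r)" by (intro compact_Times compact_cball)
  then have "uniformly_continuous_on (cball 0 r \<times> cball 0 r) (\<lambda>(u, v). spherical_dist (Some u) (Some v))"
    by (intro compact_uniformly_continuous continuous_on_subset[OF continuous_on_spherical_dist]) auto
  then obtain \<delta> where \<delta>: "\<delta> > 0" "\<And>x y. \<lbrakk>x \<in> cball 0 r \<times> cball 0 r; y \<in> cball 0 r \<times> cball 0 r; dist y x < \<delta>\<rbrakk> \<Longrightarrow>
      dist ((\<lambda>(u, v). spherical_dist (Some u) (Some v)) y) ((\<lambda>(u, v). spherical_dist (Some u) (Some v)) x) < \<epsilon>"
    using assms unfolding uniformly_continuous_on_def by metis
  show ?thesis
  proof (rule that[OF \<delta>(1)])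
    fix u v :: complex assume uv: "norm u \<le> r" "norm v \<le> r" "dist u v < \<delta>"
    have "dist (u, v) (v, v) < \<delta>" using uv by (simp add: dist_Pair_Pair)
    then have "dist (spherical_dist (Some u) (Some v)) (spherical_dist (Some v) (Some v)) < \<epsilon>"
      using \<delta>(2)[of "(v, v)" "(u, v)"] uv by simp
    then show "spherical_dist (Some u) (Some v) < \<epsilon>" by (simp add: spherical_dist_refl dist_real_def)
  qed
qed

lemma chart_convergent_on_spherical_dist:
  assumes "chart_convergent_on U \<phi> \<psi>" and "\<epsilon> > 0"
  shows "\<forall>\<^sub>F n in sequentially. \<forall>w\<in>U. spherical_dist (\<phi> n w) (\<psi> w) < \<epsilon>"
proof -
  obtain s F G where
    F: "\<forall>\<^sub>F n in sequentially. F n holomorphic_on U \<and> (\<forall>w\<in>U. \<phi> n w = chart s (F n w) \<and> norm (F n w) \<le> 2)"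
    and G: "G holomorphic_on U" "\<forall>w\<in>U. \<psi> w = chart s (G w) \<and> norm (G w) \<le> 2"
    and lim: "uniform_limit U F G sequentially"
    using assms unfolding chart_convergent_on_def by blast
  obtain \<delta> where \<delta>: "\<delta> > 0" "\<And>u v. \<lbrakk>norm u \<le> 2; norm v \<le> 2; dist u v < \<delta>\<rbrakk> \<Longrightarrow> spherical_dist (Some u) (Some v) < \<epsilon>"
    using spherical_dist_small[OF assms(2), of 2] by blast
  show ?thesis using F uniform_limitD[OF lim \<delta>(1)]
  proof eventually_elim
    case (elim n)
    then show ?case using G(2) \<delta>(2) by (auto simp: spherical_dist_chart)
  qed
qed

lemma sphere_point_inject: "sphere_point p = sphere_point q \<Longrightarrow> p = q"
proof -
  assume eq: "sphere_point p = sphere_point q"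
  have p1: "1 + (norm w)\<^sup>2 > 0" for w :: complex by (simp add: add_pos_nonneg)
  have lt: "snd (sphere_point (Some w)) \<noteq> 1" for w using p1[of w] by (simp add: sphere_point_def)
  have "u = v" if "sphere_point (Some u) = sphere_point (Some v)" for u v
  proof -
    have "1 - 2 / (1 + (norm u)\<^sup>2) = 1 - 2 / (1 + (norm v)\<^sup>2)"
      using that height_chart[of True u] height_chart[of True v] by (simp add: height_def)
    then have 1: "1 + (norm u)\<^sup>2 = 1 + (norm v)\<^sup>2" using p1[of u] p1[of v] by (simp add: field_simps)
    have "fst (sphere_point (Some u)) = fst (sphere_point (Some v))" using that by simp
    then have "2 * u / of_real (1 + (norm v)\<^sup>2) = 2 * v / of_real (1 + (norm v)\<^sup>2)"
      by (simp only: sphere_point_def option.case fst_conv 1)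
    moreover have "complex_of_real (1 + (norm v)\<^sup>2) \<noteq> 0" using p1[of v] by (metis less_irrefl of_real_eq_0_iff)
    ultimately show "u = v" by (simp del: of_real_add)
  qed
  moreover have "snd (sphere_point None) = 1" by (simp add: sphere_point_def)
  ultimately show ?thesis using eq lt by (cases p; cases q) metis+
qed

lemma chart_convergent_on_pointwise:
  assumes "chart_convergent_on U \<phi> \<psi>" and "w \<in> U"
  shows "(\<lambda>n. sphere_point (\<phi> n w)) \<longlonglongrightarrow> sphere_point (\<psi> w)"
proof -
  obtain s F G where
    F: "\<forall>\<^sub>F n in sequentially. F n holomorphic_on U \<and> (\<forall>w\<in>U. \<phi> n w = chart s (F n w) \<and> norm (F n w) \<le> 2)"
    and G: "G holomorphic_on U" "\<forall>w\<in>U. \<psi> w = chart s (G w) \<and> norm (G w) \<le> 2"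
    and lim: "uniform_limit U F G sequentially"
    using assms unfolding chart_convergent_on_def by blast
  have l: "(\<lambda>n. F n w) \<longlonglongrightarrow> G w" by (rule tendsto_uniform_limitI[OF lim assms(2)])
  have l': "(\<lambda>n. if s then F n w else cnj (F n w)) \<longlonglongrightarrow> (if s then G w else cnj (G w))"
    using l by (auto intro: tendsto_intros)
  have nz: "1 + (norm (G w))\<^sup>2 \<noteq> 0" by (simp add: add_nonneg_eq_0_iff)
  then have nz': "complex_of_real (1 + (norm (G w))\<^sup>2) \<noteq> 0" by (metis of_real_eq_0_iff)
  have "(\<lambda>n. sphere_point (chart s (F n w))) \<longlonglongrightarrow> sphere_point (chart s (G w))"
    unfolding sphere_point_chart by (intro tendsto_intros l l' nz nz')
  moreover have "\<forall>\<^sub>F n in sequentially. sphere_point (chart s (F n w)) = sphere_point (\<phi> n w)"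
    using F by eventually_elim (use assms(2) in auto)
  ultimately have "(\<lambda>n. sphere_point (\<phi> n w)) \<longlonglongrightarrow> sphere_point (chart s (G w))"
    by (rule Lim_transform_eventually)
  then show ?thesis using G(2) assms(2) by simp
qed

lemma chart_convergent_on_limit_unique:
  assumes "chart_convergent_on U \<phi> \<psi>" "chart_convergent_on V \<phi> \<psi>'" "w \<in> U" "w \<in> V"
  shows "\<psi> w = \<psi>' w"
  using chart_convergent_on_pointwise[OF assms(1,3)] chart_convergent_on_pointwise[OF assms(2,4)]
  by (metis LIMSEQ_unique sphere_point_inject)

lemma chart_convergent_on_subseq:
  assumes "chart_convergent_on U \<phi> \<psi>" "strict_mono r"
  shows "chart_convergent_on U (\<lambda>n. \<phi> (r n)) \<psi>"
proof -
  obtain s F G where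
    F: "\<forall>\<^sub>F n in sequentially. F n holomorphic_on U \<and> (\<forall>w\<in>U. \<phi> n w = chart s (F n w) \<and> norm (F n w) \<le> 2)"
    and G: "G holomorphic_on U" "\<forall>w\<in>U. \<psi> w = chart s (G w) \<and> norm (G w) \<le> 2"
    and lim: "uniform_limit U F G sequentially"
    using assms unfolding chart_convergent_on_def by blast
  have fl: "filterlim r sequentially sequentially" using assms(2) by (rule filterlim_subseq)
  have "uniform_limit U (\<lambda>n. F (r n)) G sequentially" using filterlim_compose[OF lim fl] .
  moreover have "\<forall>\<^sub>F n in sequentially. F (r n) holomorphic_on U \<and> (\<forall>w\<in>U. \<phi> (r n) w = chart s (F (r n) w) \<and> norm (F (r n) w) \<le> 2)"
    using eventually_compose_filterlim[OF F fl] .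
  ultimately show ?thesis unfolding chart_convergent_on_def using G by (intro exI[of _ s] exI[of _ "\<lambda>n. F (r n)"] exI[of _ G]) auto
qed

section \<open>Marty's criterion\<close>

lemma subsequence_deciding_predicate:
  fixes P :: "nat \<Rightarrow> bool" and A :: "nat \<Rightarrow> bool"
  assumes "\<forall>\<^sub>F n in sequentially. A n"
  obtains s r where "strict_mono (r :: nat \<Rightarrow> nat)" "\<And>n. A (r n)" "\<And>n. P (r n) \<longleftrightarrow> s"
proof -
  obtain N where N: "\<And>n. n \<ge> N \<Longrightarrow> A n" using assms unfolding eventually_sequentially by blast
  have "{N..} = {n\<in>{N..}. P n} \<union> {n\<in>{N..}. \<not> P n}" by auto
  moreover have "infinite {N..}" by (rule infinite_Ici)
  ultimately have "infinite {n\<in>{N..}. P n} \<or> infinite {n\<in>{N..}. \<not> P n}" by (metis finite_Un)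
  then have "\<exists>s. infinite {n\<in>{N..}. P n \<longleftrightarrow> s}"
  proof
    assume "infinite {n\<in>{N..}. P n}" then show ?thesis by (intro exI[of _ True]) simp
  next
    assume "infinite {n\<in>{N..}. \<not> P n}" then show ?thesis by (intro exI[of _ False]) simp
  qed
  then obtain s where "infinite {n\<in>{N..}. P n \<longleftrightarrow> s}" by (rule exE)
  from infinite_enumerate[OF this] obtain r :: "nat \<Rightarrow> nat" where r: "strict_mono r" "\<forall>n. r n \<in> {n\<in>{N..}. P n \<longleftrightarrow> s}"
    by blast
  show ?thesis
  proof (rule that[OF r(1), of s])
    fix n
    have "r n \<ge> N" "P (r n) \<longleftrightarrow> s" using r(2) by simp_all
    then show "A (r n)" "P (r n) \<longleftrightarrow> s" using N by auto
  qed
qed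

text \<open>
  Infinitely many of the maps use the same chart on a common ball by lemma \<open>bounded_chart_on_ball\<close>, and
  there their coordinates are bounded by 2, so Montel's theorem applies.
\<close>

lemma Marty_local:
  assumes e: "e > 0"
    and ev: "\<forall>\<^sub>F n in sequentially. \<forall>w\<in>ball z e. sphere_holomorphic_at (\<phi> n) w \<and> spherical_deriv (\<phi> n) w \<le> B"
  obtains d where "0 < d" "d \<le> e"
    "\<And>s. strict_mono (s :: nat \<Rightarrow> nat) \<Longrightarrow> \<exists>r \<psi>. strict_mono r \<and> chart_convergent_on (ball z d) (\<lambda>n. \<phi> (s (r n))) \<psi>"
proof -
  define B' where "B' = max B 1"
  define d where "d = min e (1 / (4 * B'))"
  have B': "B' \<ge> 1" "B \<le> B'" by (auto simp: B'_def)
  have d: "d > 0" "d \<le> e" "d * B' \<le> 1 / 4"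
  proof -
    show "d > 0" "d \<le> e" using e B' by (auto simp: d_def)
    have "d * B' \<le> (1 / (4 * B')) * B'" using B' by (intro mult_right_mono) (auto simp: d_def)
    then show "d * B' \<le> 1 / 4" using B' by simp
  qed
  have "\<exists>r \<psi>. strict_mono r \<and> chart_convergent_on (ball z (d/2)) (\<lambda>n. \<phi> (s (r n))) \<psi>"
    if s: "strict_mono s" for s :: "nat \<Rightarrow> nat"
  proof -
    have "\<forall>\<^sub>F n in sequentially. \<forall>w\<in>ball z e. sphere_holomorphic_at (\<phi> (s n)) w \<and> spherical_deriv (\<phi> (s n)) w \<le> B"
      using eventually_compose_filterlim[OF ev filterlim_subseq[OF s]] .
    then obtain c and r0 :: "nat \<Rightarrow> nat" where r0: "strict_mono r0"
      "\<And>n. \<forall>w\<in>ball z e. sphere_holomorphic_at (\<phi> (s (r0 n))) w \<and> spherical_deriv (\<phi> (s (r0 n))) w \<le> B"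
      "\<And>n. height (\<phi> (s (r0 n)) z) \<le> 0 \<longleftrightarrow> c"
      by (rule subsequence_deciding_predicate[where P = "\<lambda>n. height (\<phi> (s n) z) \<le> 0"]) (rule that; assumption)
    have "\<exists>F. F holomorphic_on ball z d \<and> (\<forall>w\<in>ball z d. \<phi> (s (r0 n)) w = chart c (F w) \<and> norm (F w) \<le> 2)" for n
    proof -
      have h: "sphere_holomorphic_at (\<phi> (s (r0 n))) w" "spherical_deriv (\<phi> (s (r0 n))) w \<le> B'" if "w \<in> ball z d" for w
      proof -
        have "w \<in> ball z e" using that d(2) by simp
        then have *: "sphere_holomorphic_at (\<phi> (s (r0 n))) w \<and> spherical_deriv (\<phi> (s (r0 n))) w \<le> B"
          using r0(2) by blast
        then show "sphere_holomorphic_at (\<phi> (s (r0 n))) w" by blast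
        from * B'(2) show "spherical_deriv (\<phi> (s (r0 n))) w \<le> B'" by linarith
      qed
      have B'0: "B' > 0" using B' by linarith
      show ?thesis
        by (rule bounded_chart_on_ball[OF h d(1,3) B'0 r0(3)[of n, symmetric]]) blast+
    qed
    then obtain F where F: "\<And>n. F n holomorphic_on ball z d"
      "\<And>n w. w \<in> ball z d \<Longrightarrow> \<phi> (s (r0 n)) w = chart c (F n w) \<and> norm (F n w) \<le> 2" by metis
    obtain G r1 where G: "G holomorphic_on ball z d" "strict_mono (r1 :: nat \<Rightarrow> nat)"
      "\<And>x. x \<in> ball z d \<Longrightarrow> (\<lambda>n. F (r1 n) x) \<longlonglongrightarrow> G x"
      "\<And>K. \<lbrakk>compact K; K \<subseteq> ball z d\<rbrakk> \<Longrightarrow> uniform_limit K (F \<circ> r1) G sequentially"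
    proof (rule Montel[of "ball z d" "range F" F])
      show "\<exists>B. \<forall>h\<in>range F. \<forall>w\<in>K. norm (h w) \<le> B" if "K \<subseteq> ball z d" for K
        by (rule exI[of _ 2]) (use that F in auto)
    qed (use F in auto)
    have Gb: "norm (G x) \<le> 2" if "x \<in> ball z d" for x
      by (rule tendsto_upperbound[OF tendsto_norm[OF G(3)[OF that]]]) (use F that in auto)
    have sub: "cball z (d/2) \<subseteq> ball z d" "ball z (d/2) \<subseteq> ball z d" using d by auto
    have ul: "uniform_limit (ball z (d/2)) (F \<circ> r1) G sequentially"
      by (rule uniform_limit_on_subset[OF G(4)[OF compact_cball sub(1)] ball_subset_cball])
    define \<psi> where "\<psi> w = chart c (G w)" for w
    have "chart_convergent_on (ball z (d/2)) (\<lambda>n. \<phi> (s ((r0 \<circ> r1) n))) \<psi>"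
      unfolding chart_convergent_on_def
    proof (intro exI conjI)
      show "uniform_limit (ball z (d/2)) (F \<circ> r1) G sequentially" by (rule ul)
      show "G holomorphic_on ball z (d/2)" by (rule holomorphic_on_subset[OF G(1) sub(2)])
      show "\<forall>w\<in>ball z (d/2). \<psi> w = chart c (G w) \<and> norm (G w) \<le> 2" using Gb sub(2) by (auto simp: \<psi>_def)
      show "\<forall>\<^sub>F n in sequentially. (F \<circ> r1) n holomorphic_on ball z (d/2) \<and>
          (\<forall>w\<in>ball z (d/2). \<phi> (s ((r0 \<circ> r1) n)) w = chart c ((F \<circ> r1) n w) \<and> norm ((F \<circ> r1) n w) \<le> 2)"
      proof (rule always_eventually, intro allI conjI ballI)
        fix n
        show "(F \<circ> r1) n holomorphic_on ball z (d/2)" unfolding o_def by (rule holomorphic_on_subset[OF F(1) sub(2)])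
        fix w assume "w \<in> ball z (d/2)"
        then have "w \<in> ball z d" using sub(2) by blast
        then show "\<phi> (s ((r0 \<circ> r1) n)) w = chart c ((F \<circ> r1) n w)" "norm ((F \<circ> r1) n w) \<le> 2"
          using F(2)[of w "r1 n"] by auto
      qed
    qed
    then show ?thesis using strict_mono_o[OF r0(1) G(2)] by blast
  qed
  then show ?thesis using d by (intro that[of "d/2"]) auto
qed

text \<open>
  A diagonal sequence over a countable cover by balls from lemma \<open>Marty_local\<close>. The bound on the
  spherical derivatives is required for large \<open>n\<close> only, with a threshold that depends on the ball: the
  rescaled functions to which the criterion is applied satisfy it in this form only.
\<close>

lemma Marty:
  assumes D: "D \<noteq> {}"
    and bnd: "\<And>z. z \<in> D \<Longrightarrow> \<exists>e>0. \<exists>B. ball z e \<subseteq> D \<and>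
      (\<forall>\<^sub>F n in sequentially. \<forall>w\<in>ball z e. sphere_holomorphic_at (\<phi> n) w \<and> spherical_deriv (\<phi> n) w \<le> B)"
  shows "\<exists>r \<psi>. strict_mono r \<and> (\<forall>z\<in>D. \<exists>e>0. ball z e \<subseteq> D \<and> chart_convergent_on (ball z e) (\<lambda>n. \<phi> (r n)) \<psi>)"
proof -
  have "\<forall>z\<in>D. \<exists>d>0. ball z d \<subseteq> D \<and> (\<forall>s. strict_mono (s :: nat \<Rightarrow> nat) \<longrightarrow>
       (\<exists>r \<psi>. strict_mono r \<and> chart_convergent_on (ball z d) (\<lambda>n. \<phi> (s (r n))) \<psi>))"
  proof
    fix z assume "z \<in> D"
    then obtain e B where e: "e > 0" "ball z e \<subseteq> D"
      and ev: "\<forall>\<^sub>F n in sequentially. \<forall>w\<in>ball z e. sphere_holomorphic_at (\<phi> n) w \<and> spherical_deriv (\<phi> n) w \<le> B"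
      using bnd by meson
    obtain d where d: "0 < d" "d \<le> e"
      "\<And>s. strict_mono (s :: nat \<Rightarrow> nat) \<Longrightarrow> \<exists>r \<psi>. strict_mono r \<and> chart_convergent_on (ball z d) (\<lambda>n. \<phi> (s (r n))) \<psi>"
      using Marty_local[OF e(1) ev] by metis
    have "ball z d \<subseteq> ball z e" using d(2) by (rule subset_ball)
    then show "\<exists>d>0. ball z d \<subseteq> D \<and> (\<forall>s. strict_mono (s :: nat \<Rightarrow> nat) \<longrightarrow>
       (\<exists>r \<psi>. strict_mono r \<and> chart_convergent_on (ball z d) (\<lambda>n. \<phi> (s (r n))) \<psi>))"
      using d e by blast
  qed
  then obtain d where d: "\<And>z. z \<in> D \<Longrightarrow> d z > 0" "\<And>z. z \<in> D \<Longrightarrow> ball z (d z) \<subseteq> D"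
    "\<And>z s. \<lbrakk>z \<in> D; strict_mono (s :: nat \<Rightarrow> nat)\<rbrakk> \<Longrightarrow> \<exists>r \<psi>. strict_mono r \<and> chart_convergent_on (ball z (d z)) (\<lambda>n. \<phi> (s (r n))) \<psi>"
    by metis
  define \<B> where "\<B> = (\<lambda>z. ball z (d z)) ` D"
  obtain \<C> where \<C>: "\<C> \<subseteq> \<B>" "countable \<C>" "\<Union>\<C> = \<Union>\<B>" using Lindelof[of \<B>] by (auto simp: \<B>_def)
  have cover: "\<Union>\<B> = D" using d(1,2) by (force simp: \<B>_def)
  have "\<C> \<noteq> {}" using D \<C> cover by auto
  then obtain U where U: "\<C> = range (U :: nat \<Rightarrow> complex set)" using \<C>(2) by (metis range_from_nat_into)
  have UB: "U k \<in> \<B>" for k using U \<C>(1) by blast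
  have UD: "open (U k)" "U k \<subseteq> D" for k using UB[of k] d(2) unfolding \<B>_def by auto
  define P where "P k s \<longleftrightarrow> (\<exists>\<psi>. chart_convergent_on (U k) (\<lambda>n. \<phi> (s n)) \<psi>)" for k s
  interpret subseqs P
  proof
    fix k and s :: "nat \<Rightarrow> nat" assume s: "strict_mono s"
    obtain z where z: "z \<in> D" "U k = ball z (d z)" using U \<C>(1) by (auto simp: \<B>_def)
    show "\<exists>r'. strict_mono r' \<and> P k (s \<circ> r')" unfolding P_def z(2) o_def using d(3)[OF z(1) s] by blast
  qed
  have Pd: "P k diagseq" for k
  proof -
    have "P k (diagseq \<circ> ((+) (Suc k)))"
    proof (rule diagseq_holds)
      fix r s :: "nat \<Rightarrow> nat" and n assume "strict_mono r" "P n s"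
      then show "P n (s \<circ> r)" unfolding P_def o_def using chart_convergent_on_subseq by blast
    qed
    then obtain \<psi> where \<psi>: "chart_convergent_on (U k) (\<lambda>n. \<phi> (diagseq (Suc k + n))) \<psi>" unfolding P_def o_def by blast
    obtain s F G where
      F: "\<forall>\<^sub>F n in sequentially. F n holomorphic_on U k \<and> (\<forall>w\<in>U k. \<phi> (diagseq (Suc k + n)) w = chart s (F n w) \<and> norm (F n w) \<le> 2)"
      and G: "G holomorphic_on U k" "\<forall>w\<in>U k. \<psi> w = chart s (G w) \<and> norm (G w) \<le> 2"
      and lim: "uniform_limit (U k) F G sequentially"
      using \<psi> unfolding chart_convergent_on_def by blast
    have fl: "filterlim (\<lambda>n. n - Suc k) sequentially sequentially" by (rule filterlim_minus_const_nat_at_top)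
    have "uniform_limit (U k) (\<lambda>n. F (n - Suc k)) G sequentially" using filterlim_compose[OF lim fl] .
    moreover have "\<forall>\<^sub>F n in sequentially. F (n - Suc k) holomorphic_on U k \<and>
        (\<forall>w\<in>U k. \<phi> (diagseq n) w = chart s (F (n - Suc k) w) \<and> norm (F (n - Suc k) w) \<le> 2)"
      using eventually_compose_filterlim[OF F fl] eventually_ge_at_top[of "Suc k"]
      by eventually_elim simp
    ultimately have "chart_convergent_on (U k) (\<lambda>n. \<phi> (diagseq n)) \<psi>"
      unfolding chart_convergent_on_def using G by (intro exI[of _ s] exI[of _ "\<lambda>n. F (n - Suc k)"] exI[of _ G]) auto
    then show ?thesis unfolding P_def by blast
  qed
  then obtain \<Psi> where \<Psi>: "\<And>k. chart_convergent_on (U k) (\<lambda>n. \<phi> (diagseq n)) (\<Psi> k)" unfolding P_def by metis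
  \<comment> \<open>The local limits agree on overlaps because limits on the sphere are unique, so any choice of \<open>k\<close> will do.\<close>
  define \<psi> where "\<psi> w = \<Psi> (SOME k. w \<in> U k) w" for w
  have \<psi>: "\<psi> w = \<Psi> k w" if "w \<in> U k" for w k
    unfolding \<psi>_def by (rule chart_convergent_on_limit_unique[OF \<Psi> \<Psi> someI[of "\<lambda>k. w \<in> U k"]]) (use that in auto)
  show ?thesis
  proof (rule exI[of _ diagseq], rule exI[of _ \<psi>], intro conjI ballI)
    show "strict_mono diagseq" by (rule subseq_diagseq)
    fix z assume "z \<in> D"
    then obtain k where k: "z \<in> U k" using \<C>(3) cover U by auto
    then obtain e where e: "e > 0" "ball z e \<subseteq> U k" using UD(1) open_contains_ball by blast
    obtain s F G where
      F: "\<forall>\<^sub>F n in sequentially. F n holomorphic_on U k \<and> (\<forall>w\<in>U k. \<phi> (diagseq n) w = chart s (F n w) \<and> norm (F n w) \<le> 2)"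
      and G: "G holomorphic_on U k" "\<forall>w\<in>U k. \<Psi> k w = chart s (G w) \<and> norm (G w) \<le> 2"
      and lim: "uniform_limit (U k) F G sequentially"
      using \<Psi>[of k] unfolding chart_convergent_on_def by blast
    have "chart_convergent_on (ball z e) (\<lambda>n. \<phi> (diagseq n)) \<psi>"
      unfolding chart_convergent_on_def
    proof (intro exI conjI)
      show "uniform_limit (ball z e) F G sequentially" by (rule uniform_limit_on_subset[OF lim e(2)])
      show "G holomorphic_on ball z e" by (rule holomorphic_on_subset[OF G(1) e(2)])
      show "\<forall>w\<in>ball z e. \<psi> w = chart s (G w) \<and> norm (G w) \<le> 2" using G(2) \<psi> e(2) by (metis subsetD)
      show "\<forall>\<^sub>F n in sequentially. F n holomorphic_on ball z e \<and>
          (\<forall>w\<in>ball z e. \<phi> (diagseq n) w = chart s (F n w) \<and> norm (F n w) \<le> 2)"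
        using F by eventually_elim (use e(2) holomorphic_on_subset in blast)
    qed
    then show "\<exists>e>0. ball z e \<subseteq> D \<and> chart_convergent_on (ball z e) (\<lambda>n. \<phi> (diagseq n)) \<psi>"
      using e UD(2) by blast
  qed
qed

section \<open>Sphere-valued maps and meromorphic functions\<close>

text \<open>
  The identity theorem for a property that is described near each point as the vanishing of a
  holomorphic function, without a globally defined function. It is applied to the poles of a
  sphere-valued map and to the zeros of its spherical derivative.
\<close>

lemma identity_principle_local_zero_sets:
  assumes D: "open D" "connected D"
    and loc: "\<And>z. z \<in> D \<Longrightarrow> \<exists>e>0. \<exists>H. ball z e \<subseteq> D \<and> H holomorphic_on ball z e \<and> (\<forall>w\<in>ball z e. Q w \<longleftrightarrow> H w = 0)"
    and z0: "z0 \<in> D" "\<forall>\<^sub>F w in nhds z0. Q w" and z: "z \<in> D"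
  shows "Q z"
proof -
  define A where "A = {z\<in>D. \<forall>\<^sub>F w in nhds z. Q w}"
  have "open A"
  proof (subst open_subopen, rule ballI)
    fix z assume z: "z \<in> A"
    then obtain S where S: "open S" "z \<in> S" "\<And>w. w \<in> S \<Longrightarrow> Q w" unfolding A_def eventually_nhds by blast
    have "S \<inter> D \<subseteq> A" using S by (auto simp: A_def eventually_nhds)
    then show "\<exists>T. open T \<and> z \<in> T \<and> T \<subseteq> A" using S z D(1) by (intro exI[of _ "S \<inter> D"]) (auto simp: A_def)
  qed
  moreover have "open (D - A)"
  proof (subst open_subopen, rule ballI)
    fix z assume z: "z \<in> D - A"
    then obtain e H where e: "e > 0" "ball z e \<subseteq> D" and H: "H holomorphic_on ball z e" "\<And>w. w \<in> ball z e \<Longrightarrow> Q w \<longleftrightarrow> H w = 0"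
      using loc by blast
    have "ball z e \<inter> A = {}"
    proof (rule ccontr)
      assume "ball z e \<inter> A \<noteq> {}"
      then obtain w where w: "w \<in> ball z e" "w \<in> A" by blast
      have ev: "\<forall>\<^sub>F v in nhds w. Q v" using w by (simp add: A_def)
      have "\<exists>v\<in>ball z e. H v \<noteq> 0"
      proof (rule ccontr)
        assume "\<not> ?thesis"
        then have q: "Q v" if "v \<in> ball z e" for v using H(2) that by blast
        have "\<forall>\<^sub>F v in nhds z. v \<in> ball z e" by (rule eventually_nhds_in_open) (use e in auto)
        then have "\<forall>\<^sub>F v in nhds z. Q v" by (rule eventually_mono) (rule q)
        then show False using z by (simp add: A_def)
      qed
      then obtain v where v: "v \<in> ball z e" "H v \<noteq> 0" by blast
      have "\<forall>\<^sub>F u in at w. H u \<noteq> 0 \<and> u \<in> ball z e"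
        by (rule non_zero_neighbour_alt[OF H(1) open_ball connected_ball w(1) v])
      moreover have "\<forall>\<^sub>F u in at w. Q u" using ev by (simp add: eventually_nhds_conv_at)
      ultimately have "\<forall>\<^sub>F u in at w. False" by eventually_elim (use H(2) in blast)
      then show False by simp
    qed
    then show "\<exists>T. open T \<and> z \<in> T \<and> T \<subseteq> D - A" using e by (intro exI[of _ "ball z e"]) auto
  qed
  moreover have "z0 \<in> A" using z0 by (simp add: A_def)
  ultimately have "D - A = {}"
    using connectedD[OF D(2), of A "D - A"] z0(1) by (auto simp: A_def)
  then have "z \<in> A" using z by blast
  then show ?thesis unfolding A_def using eventually_nhds_x_imp_x by blast
qed

lemma sphere_holomorphic_chart_in:
  assumes "sphere_holomorphic_at \<phi> z" "open D" "z \<in> D"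
  shows "\<exists>s F e. 0 < e \<and> ball z e \<subseteq> D \<and> F holomorphic_on ball z e \<and> (\<forall>w\<in>ball z e. \<phi> w = chart s (F w))"
proof -
  obtain s F e where e: "0 < e" "F holomorphic_on ball z e" "\<And>w. w \<in> ball z e \<Longrightarrow> \<phi> w = chart s (F w)"
    using assms(1) unfolding sphere_holomorphic_at_def by blast
  obtain e' where e': "e' > 0" "ball z e' \<subseteq> D" using assms open_contains_ball by blast
  show ?thesis
  proof (intro exI conjI)
    show "0 < min e e'" "ball z (min e e') \<subseteq> D" using e e' by auto
    show "F holomorphic_on ball z (min e e')" by (rule holomorphic_on_subset[OF e(2)]) auto
    show "\<forall>w\<in>ball z (min e e'). \<phi> w = chart s (F w)" using e(3) by auto
  qed
qed

text \<open>
  By the identity principle the points with value infinity are isolated. At such a point the coordinate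
  in the chart at infinity has an isolated zero, so its reciprocal has a pole, and the default value 0
  of \<open>finite_value\<close> is the one that a nicely meromorphic function takes there.
\<close>

lemma sphere_holomorphic_imp_meromorphic:
  assumes D: "open D" "connected D" and hol: "\<And>z. z \<in> D \<Longrightarrow> sphere_holomorphic_at \<psi> z"
    and nN: "z0 \<in> D" "\<psi> z0 \<noteq> None"
  obtains g where "g nicely_meromorphic_on D" "\<And>z. z \<in> D \<Longrightarrow> \<psi> z = mero_value g z"
proof -
  have isolated: "\<not> (\<forall>\<^sub>F w in nhds z. \<psi> w = None)" if "z \<in> D" for z
  proof
    assume ev: "\<forall>\<^sub>F w in nhds z. \<psi> w = None"
    have "\<psi> z0 = None"
    proof (rule identity_principle_local_zero_sets[OF D _ that ev nN(1)])
      fix y assume y: "y \<in> D"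
      obtain s F e where e: "0 < e" "ball y e \<subseteq> D" "F holomorphic_on ball y e" "\<And>w. w \<in> ball y e \<Longrightarrow> \<psi> w = chart s (F w)"
        using sphere_holomorphic_chart_in[OF hol[OF y] D(1) y] by blast
      show "\<exists>e>0. \<exists>H. ball y e \<subseteq> D \<and> H holomorphic_on ball y e \<and> (\<forall>w\<in>ball y e. (\<psi> w = None) = (H w = 0))"
        using e by (intro exI[of _ e] exI[of _ "\<lambda>w. if s then 1 else F w"] conjI; cases s; auto)
    qed
    then show False using nN by simp
  qed
  define g where "g w = finite_value (\<psi> w)" for w
  have fin: "g analytic_on {z} \<and> mero_value g z = \<psi> z" if z: "z \<in> D" "\<psi> z \<noteq> None" for z
  proof -
    obtain s F e where e: "0 < e" "ball z e \<subseteq> D" "F holomorphic_on ball z e" "\<And>w. w \<in> ball z e \<Longrightarrow> \<psi> w = chart s (F w)"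
      using sphere_holomorphic_chart_in[OF hol[OF z(1)] D(1) z(1)] by blast
    have F: "F analytic_on {z}" using e by (auto simp: analytic_at intro!: exI[of _ "ball z e"])
    have ev: "\<forall>\<^sub>F w in nhds z. w \<in> ball z e" by (rule eventually_nhds_in_open) (use e in auto)
    have "g analytic_on {z}"
    proof (cases s)
      case True
      have "\<forall>\<^sub>F w in nhds z. g w = F w" using ev by eventually_elim (simp add: e(4) True g_def)
      then show ?thesis using F by (subst analytic_at_cong) auto
    next
      case False
      have "\<forall>\<^sub>F w in nhds z. g w = inverse (F w)" using ev by eventually_elim (simp add: e(4) False g_def)
      moreover have "F z \<noteq> 0" using z(2) e(1) e(4)[of z] False by auto
      then have "(\<lambda>w. inverse (F w)) analytic_on {z}" using F by (intro analytic_intros) auto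
      ultimately show ?thesis by (subst analytic_at_cong) auto
    qed
    then show ?thesis using z(2) by (auto simp: mero_value_def g_def dest: analytic_at_imp_no_pole)
  qed
  have pol: "g meromorphic_on {z} \<and> is_pole g z" if z: "z \<in> D" "\<psi> z = None" for z
  proof -
    obtain s F e where e: "0 < e" "ball z e \<subseteq> D" "F holomorphic_on ball z e" "\<And>w. w \<in> ball z e \<Longrightarrow> \<psi> w = chart s (F w)"
      using sphere_holomorphic_chart_in[OF hol[OF z(1)] D(1) z(1)] by blast
    have F: "F analytic_on {z}" using e by (auto simp: analytic_at intro!: exI[of _ "ball z e"])
    have s: "\<not> s" "F z = 0" using e(1) e(4)[of z] z(2) chart_eq_None[of s "F z"] by auto
    have ev: "\<forall>\<^sub>F w in nhds z. w \<in> ball z e" by (rule eventually_nhds_in_open) (use e in auto)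
    have "\<not> (\<forall>\<^sub>F w in at z. F w = 0)"
    proof
      assume "\<forall>\<^sub>F w in at z. F w = 0"
      then have "\<forall>\<^sub>F w in nhds z. F w = 0" using s by (simp add: eventually_nhds_conv_at)
      with ev have "\<forall>\<^sub>F w in nhds z. \<psi> w = None" by eventually_elim (use e(4) s in auto)
      then show False using isolated[OF z(1)] by simp
    qed
    then have iz: "isolated_zero F z" using non_isolated_zero_imp_eventually_zero[OF F s(2)] by blast
    have "\<forall>\<^sub>F w in nhds z. g w = inverse (F w)" using ev by eventually_elim (simp add: e(4) s g_def)
    then have gi: "\<forall>\<^sub>F w in at z. g w = inverse (F w)" by (simp add: eventually_nhds_conv_at)
    have "is_pole g z" using is_pole_cong[OF gi refl] is_pole_inverse_iff[of F z] iz by blast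
    moreover have "(\<lambda>w. inverse (F w)) meromorphic_on {z}"
      by (intro meromorphic_intros analytic_on_imp_meromorphic_on F)
    then have "g meromorphic_on {z}" using meromorphic_on_cong[of "{z}" g "\<lambda>w. inverse (F w)" "{z}"] gi by simp
    ultimately show ?thesis by blast
  qed
  show ?thesis
  proof (rule that)
    show "\<psi> z = mero_value g z" if "z \<in> D" for z
      using fin[OF that] pol[OF that] by (cases "\<psi> z") (auto simp: mero_value_def)
    show "g nicely_meromorphic_on D"
      unfolding nicely_meromorphic_on_def
    proof (intro conjI ballI)
      show "g meromorphic_on D"
        using fin pol analytic_on_imp_meromorphic_on by (subst meromorphic_on_meromorphic_at) blast
      fix z assume z: "z \<in> D"
      show "is_pole g z \<and> g z = 0 \<or> g \<midarrow>z\<rightarrow> g z"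
      proof (cases "\<psi> z = None")
        case True
        then show ?thesis using pol[OF z] by (simp add: g_def)
      next
        case False
        then show ?thesis using fin[OF z] analytic_at_imp_isCont isContD by blast
      qed
    qed
  qed
qed

text \<open>
  Near a pole the reciprocal extends holomorphically by 0, and the extension is the coordinate in the
  chart at infinity.
\<close>

lemma mero_value_sphere_holomorphic:
  assumes f: "f nicely_meromorphic_on D" and z: "z \<in> D"
  shows "sphere_holomorphic_at (mero_value f) z"
proof (cases "is_pole f z")
  case False
  then have "f analytic_on {z}" using nicely_meromorphic_on_imp_analytic_at[OF f z] by blast
  then obtain e where e: "e > 0" "f holomorphic_on ball z e" using analytic_on_def by auto
  have "mero_value f w = chart True (f w)" if "w \<in> ball z e" for w
    using not_is_pole_holomorphic[OF open_ball that e(2)] by (simp add: mero_value_def)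
  then show ?thesis using e unfolding sphere_holomorphic_at_def by blast
next
  case True
  have "f meromorphic_on {z}" using f z meromorphic_on_subset[of f D "{z}"] by (auto simp: nicely_meromorphic_on_def)
  then have "isolated_singularity_at f z" by (rule meromorphic_on_isolated_singularity)
  then obtain r where r: "r > 0" "f analytic_on ball z r - {z}" by (auto simp: isolated_singularity_at_def)
  obtain r' where r': "r' > 0" "\<And>w. \<lbrakk>w \<noteq> z; dist w z < r'\<rbrakk> \<Longrightarrow> f w \<noteq> 0"
    using non_zero_neighbour_pole[OF True] unfolding eventually_at by auto
  define e where "e = min r r'"
  have e: "e > 0" "f analytic_on ball z e - {z}"
    using r r' by (auto simp: e_def intro: analytic_on_subset)
  have nz: "\<forall>x\<in>ball z e - {z}. f x \<noteq> 0" using r' by (auto simp: e_def dist_commute)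
  define F where "F w = (if w = z then 0 else inverse (f w))" for w
  have F: "F holomorphic_on ball z e" unfolding F_def
    by (rule is_pole_inverse_holomorphic[OF open_ball analytic_imp_holomorphic[OF e(2)] True nz])
  have "mero_value f w = chart False (F w)" if "w \<in> ball z e" for w
  proof (cases "w = z")
    case False
    then have "f analytic_on {w}" using e(2) that analytic_on_subset[of f "ball z e - {z}" "{w}"] by auto
    then show ?thesis using False nz that analytic_at_imp_no_pole by (auto simp: mero_value_def F_def chart_def)
  qed (use True in \<open>simp add: mero_value_def F_def chart_def\<close>)
  then show ?thesis using e F unfolding sphere_holomorphic_at_def by blast
qed

section \<open>Values of spherical limits\<close>

text \<open>
  Where the limit is finite, convergence in the chart at infinity can be rewritten on a smaller ball as
  convergence of the functions themselves. The bound by 2 is lost.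
\<close>

lemma chart_convergent_on_finite:
  assumes e: "e > 0" and conv: "chart_convergent_on (ball z e) \<phi> \<psi>" and fin: "\<psi> z \<noteq> None"
  obtains d F G where "0 < d" "d \<le> e"
    "\<forall>\<^sub>F n in sequentially. F n holomorphic_on ball z d \<and> (\<forall>w\<in>ball z d. \<phi> n w = Some (F n w))"
    "G holomorphic_on ball z d" "\<forall>w\<in>ball z d. \<psi> w = Some (G w)"
    "uniform_limit (ball z d) F G sequentially"
proof -
  obtain s F G where
    F: "\<forall>\<^sub>F n in sequentially. F n holomorphic_on ball z e \<and> (\<forall>w\<in>ball z e. \<phi> n w = chart s (F n w) \<and> norm (F n w) \<le> 2)"
    and G: "G holomorphic_on ball z e" "\<forall>w\<in>ball z e. \<psi> w = chart s (G w) \<and> norm (G w) \<le> 2"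
    and lim: "uniform_limit (ball z e) F G sequentially"
    using conv unfolding chart_convergent_on_def by blast
  show ?thesis
  proof (cases s)
    case True
    show ?thesis
      by (rule that[OF e order_refl _ G(1) _ lim]) (use F G True in \<open>auto elim!: eventually_mono\<close>)
  next
    case False
    have z: "z \<in> ball z e" using e by simp
    then have Gz: "G z \<noteq> 0" using fin G(2) False by auto
    define m where "m = norm (G z) / 2"
    have m: "m > 0" using Gz by (simp add: m_def)
    have "isCont G z" using G(1) z by (meson continuous_on_eq_continuous_at holomorphic_on_imp_continuous_on open_ball)
    then obtain d0 where d0: "d0 > 0" "\<And>w. dist w z < d0 \<Longrightarrow> dist (G w) (G z) < m"
      using m unfolding continuous_at_eps_delta by blast
    define d where "d = min d0 e"
    have d: "0 < d" "d \<le> e" "ball z d \<subseteq> ball z e" using d0 e by (auto simp: d_def)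
    have Gm: "m \<le> norm (G w)" if "w \<in> ball z d" for w
    proof -
      have "dist (G w) (G z) < m" using d0(2)[of w] that by (simp add: d_def dist_commute)
      then have "norm (G z - G w) < m" by (simp add: dist_norm norm_minus_commute)
      moreover have "norm (G z) \<le> norm (G w) + norm (G z - G w)" by (rule norm_triangle_sub)
      ultimately show ?thesis by (simp add: m_def)
    qed
    have lim': "uniform_limit (ball z d) F G sequentially" by (rule uniform_limit_on_subset[OF lim d(3)])
    have "uniform_limit (ball z d) (\<lambda>n w. inverse (F n w)) (inverse \<circ> G) sequentially"
      by (rule uniform_lim_inverse[OF lim' Gm m])
    then have ul: "uniform_limit (ball z d) (\<lambda>n w. inverse (F n w)) (\<lambda>w. inverse (G w)) sequentially" by (simp add: o_def)
    show ?thesis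
    proof (rule that[OF d(1,2) _ _ _ ul])
      have "\<forall>w\<in>ball z d. G w \<noteq> 0" using Gm m by fastforce
      then show "(\<lambda>w. inverse (G w)) holomorphic_on ball z d"
        by (intro holomorphic_intros holomorphic_on_subset[OF G(1) d(3)]) auto
      show "\<forall>w\<in>ball z d. \<psi> w = Some (inverse (G w))"
        using G(2) d(3) False \<open>\<forall>w\<in>ball z d. G w \<noteq> 0\<close> by (auto simp: chart_def)
      show "\<forall>\<^sub>F n in sequentially. (\<lambda>w. inverse (F n w)) holomorphic_on ball z d \<and>
          (\<forall>w\<in>ball z d. \<phi> n w = Some (inverse (F n w)))"
        using F uniform_limitD[OF lim' m]
      proof eventually_elim
        case (elim n)
        have nz: "F n w \<noteq> 0" if "w \<in> ball z d" for w
        proof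
          assume "F n w = 0"
          moreover have "dist (F n w) (G w) < m" using elim(2) that by blast
          ultimately have "norm (G w) < m" by (simp add: dist_norm)
          then show False using Gm[OF that] by simp
        qed
        have "F n holomorphic_on ball z d" using elim(1) holomorphic_on_subset d(3) by blast
        then have "(\<lambda>w. inverse (F n w)) holomorphic_on ball z d" using nz by (intro holomorphic_intros) auto
        moreover have "\<phi> n w = Some (inverse (F n w))" if "w \<in> ball z d" for w
        proof -
          have "\<phi> n w = chart s (F n w)" using elim(1) that d(3) by blast
          then show ?thesis using nz[OF that] False by (simp add: chart_def)
        qed
        ultimately show ?case by blast
      qed
    qed
  qed
qed

text \<open>
  The counterparts for maps into the sphere of \<open>Hurwitz_simple_value_omitted\<close> and
  \<open>Hurwitz_ramified_value\<close>. The fact \<open>core\<close> passes to a ball and to a tail of the sequence on which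
  everything is finite and the hypothesis on the values holds for every index.
\<close>

lemma limit_ramification:
  assumes e: "e > 0" and conv: "chart_convergent_on (ball z e) \<phi> \<psi>"
    and nonconst: "\<not> (\<forall>\<^sub>F w in nhds z. spherical_deriv \<psi> w = 0)"
  shows limit_omits_simple_value:
     "\<lbrakk>\<epsilon> \<longlonglongrightarrow> 0; \<And>n. \<epsilon> n \<noteq> (0::complex);
       \<forall>\<^sub>F n in sequentially. \<forall>w\<in>ball z e. \<phi> n w = Some b \<longrightarrow> deriv (\<lambda>v. finite_value (\<phi> n v)) w = \<epsilon> n\<rbrakk>
      \<Longrightarrow> \<psi> z \<noteq> Some b"
    and limit_ramified_value:
     "\<lbrakk>\<eta> \<longlonglongrightarrow> (0::real);
       \<forall>\<^sub>F n in sequentially. \<forall>w\<in>ball z e. \<phi> n w = Some a \<longrightarrow> norm (deriv (\<lambda>v. finite_value (\<phi> n v)) w) \<le> \<eta> n;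
       \<psi> z = Some a\<rbrakk> \<Longrightarrow> spherical_deriv \<psi> z = 0"
proof -
  have core: "\<exists>d F G N. 0 < d \<and> (\<forall>n. F n holomorphic_on ball z d) \<and> G holomorphic_on ball z d \<and>
      uniform_limit (ball z d) F G sequentially \<and> \<not> G constant_on ball z d \<and> \<psi> z = Some (G z) \<and>
      spherical_deriv \<psi> z = norm (deriv G z) / (1 + (norm (G z))\<^sup>2) \<and>
      (\<forall>n. \<forall>w\<in>ball z d. w \<in> ball z e \<and> \<phi> (n + N) w = Some (F n w) \<and> P (n + N) w \<and>
         deriv (\<lambda>v. finite_value (\<phi> (n + N) v)) w = deriv (F n) w)"
    if fin: "\<psi> z \<noteq> None" and P: "\<forall>\<^sub>F n in sequentially. \<forall>w\<in>ball z e. P n w" for P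
  proof -
    obtain d F G where d: "0 < d" "d \<le> e"
      and F: "\<forall>\<^sub>F n in sequentially. F n holomorphic_on ball z d \<and> (\<forall>w\<in>ball z d. \<phi> n w = Some (F n w))"
      and G: "G holomorphic_on ball z d" "\<forall>w\<in>ball z d. \<psi> w = Some (G w)"
      and lim: "uniform_limit (ball z d) F G sequentially"
      by (rule chart_convergent_on_finite[OF e conv fin]) (rule that; assumption)
    obtain N where N: "\<And>n. n \<ge> N \<Longrightarrow> F n holomorphic_on ball z d \<and> (\<forall>w\<in>ball z d. \<phi> n w = Some (F n w)) \<and> (\<forall>w\<in>ball z e. P n w)"
      using eventually_conj[OF F P] unfolding eventually_sequentially by blast
    have sub: "ball z d \<subseteq> ball z e" using d(2) by (rule subset_ball)
    have sd: "spherical_deriv \<psi> w = norm (deriv G w) / (1 + (norm (G w))\<^sup>2)" if "w \<in> ball z d" for w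
      by (rule spherical_deriv_chart[OF open_ball that G(1), of _ True]) (use G(2) in auto)
    have nc: "\<not> G constant_on ball z d"
    proof
      assume "G constant_on ball z d"
      then obtain y where y: "\<And>w. w \<in> ball z d \<Longrightarrow> G w = y" unfolding constant_on_def by blast
      have z: "spherical_deriv \<psi> w = 0" if "w \<in> ball z d" for w
        using sd[OF that] deriv_cong_open[OF open_ball that, of G "\<lambda>_. y"] y by simp
      have "\<forall>\<^sub>F w in nhds z. w \<in> ball z d" by (rule eventually_nhds_in_open) (use d in auto)
      then have "\<forall>\<^sub>F w in nhds z. spherical_deriv \<psi> w = 0" by (rule eventually_mono) (rule z)
      then show False using nonconst by simp
    qed
    have zd: "z \<in> ball z d" using d by simp
    have ul: "uniform_limit (ball z d) (\<lambda>n. F (n + N)) G sequentially"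
      by (rule filterlim_compose[OF lim]) (rule filterlim_add_const_nat_at_top)
    have dd: "deriv (\<lambda>v. finite_value (\<phi> (n + N) v)) w = deriv (F (n + N)) w" if "w \<in> ball z d" for n w
      by (rule deriv_cong_open[OF open_ball that]) (use N[of "n + N"] in simp)
    show ?thesis
      by (rule exI[of _ d], rule exI[of _ "\<lambda>n. F (n + N)"], rule exI[of _ G], rule exI[of _ N])
         (use d N G nc sd[OF zd] zd ul dd sub in auto)
  qed
  {
    assume \<epsilon>: "\<epsilon> \<longlonglongrightarrow> 0" "\<And>n. \<epsilon> n \<noteq> (0::complex)"
      and sh: "\<forall>\<^sub>F n in sequentially. \<forall>w\<in>ball z e. \<phi> n w = Some b \<longrightarrow> deriv (\<lambda>v. finite_value (\<phi> n v)) w = \<epsilon> n"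
    show "\<psi> z \<noteq> Some b"
    proof
      assume b: "\<psi> z = Some b"
      then have fin: "\<psi> z \<noteq> None" by simp
      obtain d F G N where d: "0 < d" and F: "\<forall>n. F n holomorphic_on ball z d" and G: "G holomorphic_on ball z d"
        and ul: "uniform_limit (ball z d) F G sequentially" and nc: "\<not> G constant_on ball z d" and Gz: "\<psi> z = Some (G z)"
        and all: "\<forall>n. \<forall>w\<in>ball z d. w \<in> ball z e \<and> \<phi> (n + N) w = Some (F n w) \<and>
          (\<phi> (n + N) w = Some b \<longrightarrow> deriv (\<lambda>v. finite_value (\<phi> (n + N) v)) w = \<epsilon> (n + N)) \<and>
          deriv (\<lambda>v. finite_value (\<phi> (n + N) v)) w = deriv (F n) w"
        using core[OF fin sh] by (elim exE conjE) (rule that; assumption)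
      have "G z \<noteq> b"
      proof (rule Hurwitz_simple_value_omitted[OF d _ G ul, of "\<lambda>n. \<epsilon> (n + N)"])
        show "(\<lambda>n. \<epsilon> (n + N)) \<longlonglongrightarrow> 0" using \<epsilon>(1) by (rule LIMSEQ_ignore_initial_segment)
        show "deriv (F n) w = \<epsilon> (n + N)" if "w \<in> ball z d" "F n w = b" for n w
          using all[rule_format, OF that(1), of n] that(2) by metis
      qed (use F \<epsilon>(2) nc in auto)
      then show False using b Gz by simp
    qed
  }
  {
    assume \<eta>: "\<eta> \<longlonglongrightarrow> (0::real)" and a: "\<psi> z = Some a"
      and sh: "\<forall>\<^sub>F n in sequentially. \<forall>w\<in>ball z e. \<phi> n w = Some a \<longrightarrow> norm (deriv (\<lambda>v. finite_value (\<phi> n v)) w) \<le> \<eta> n"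
    have fin: "\<psi> z \<noteq> None" using a by simp
    obtain d F G N where d: "0 < d" and F: "\<forall>n. F n holomorphic_on ball z d" and G: "G holomorphic_on ball z d"
      and ul: "uniform_limit (ball z d) F G sequentially" and nc: "\<not> G constant_on ball z d" and Gz: "\<psi> z = Some (G z)"
      and sd: "spherical_deriv \<psi> z = norm (deriv G z) / (1 + (norm (G z))\<^sup>2)"
      and all: "\<forall>n. \<forall>w\<in>ball z d. w \<in> ball z e \<and> \<phi> (n + N) w = Some (F n w) \<and>
        (\<phi> (n + N) w = Some a \<longrightarrow> norm (deriv (\<lambda>v. finite_value (\<phi> (n + N) v)) w) \<le> \<eta> (n + N)) \<and>
        deriv (\<lambda>v. finite_value (\<phi> (n + N) v)) w = deriv (F n) w"
      using core[OF fin sh] by (elim exE conjE) (rule that; assumption)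
    have "deriv G z = 0"
    proof (rule Hurwitz_ramified_value[OF d _ G ul, of "\<lambda>n. \<eta> (n + N)" a])
      show "(\<lambda>n. \<eta> (n + N)) \<longlonglongrightarrow> 0" using \<eta> by (rule LIMSEQ_ignore_initial_segment)
      show "norm (deriv (F n) w) \<le> \<eta> (n + N)" if "w \<in> ball z d" "F n w = a" for n w
        using all[rule_format, OF that(1), of n] that(2) by metis
    qed (use F nc a Gz in auto)
    then show "spherical_deriv \<psi> z = 0" using sd by simp
  }
qed

section \<open>Maps of the plane that omit two values and ramify over a third\<close>

text \<open>
  In a chart \<open>u = p / q\<close> with \<open>p\<close> and \<open>q\<close> affine in the coordinate \<open>F\<close>, and
  \<open>u' = \<plusminus>(b - c) F' / q\<^sup>2\<close>. The estimate on the set \<open>|u| = 1\<close>, that is \<open>|p| = |q|\<close>, rests on an identity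
  valid in both charts,
  \<open>|b - c|\<^sup>2 (1 + |F|\<^sup>2) = |q - p|\<^sup>2 + |c p - b q|\<^sup>2\<close>,
  whose right-hand side is at most \<open>(4 + (|b| + |c|)\<^sup>2) |q|\<^sup>2\<close>.
\<close>

lemma omitting_quotient_derivative:
  assumes hol: "sphere_holomorphic_at \<psi> z" and bc: "b \<noteq> c" and om: "\<And>w. \<psi> w \<noteq> Some b" "\<And>w. \<psi> w \<noteq> Some c"
  defines "u \<equiv> (\<lambda>w. case \<psi> w of None \<Rightarrow> 1 | Some v \<Rightarrow> (v - b) / (v - c))"
  shows "\<exists>D. (u has_field_derivative D) (at z) \<and> (D = 0 \<longleftrightarrow> spherical_deriv \<psi> z = 0) \<and>
     (norm (u z) = 1 \<longrightarrow> norm D \<le> (4 + (norm b + norm c)\<^sup>2) / norm (b - c) * spherical_deriv \<psi> z)"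
proof -
  obtain s F e where e: "0 < e" "F holomorphic_on ball z e" "\<And>w. w \<in> ball z e \<Longrightarrow> \<psi> w = chart s (F w)"
    using hol unfolding sphere_holomorphic_at_def by blast
  have ev: "\<forall>\<^sub>F w in nhds z. w \<in> ball z e" by (rule eventually_nhds_in_open) (use e in auto)
  have z: "z \<in> ball z e" using e by simp
  define p where "p v = (if s then v - b else 1 - b * v)" for v
  define q where "q v = (if s then v - c else 1 - c * v)" for v
  have nz: "p (F w) \<noteq> 0" "q (F w) \<noteq> 0" if w: "w \<in> ball z e" for w
  proof -
    have "\<psi> w = chart s (F w)" using e(3)[OF w] .
    then have "chart s (F w) \<noteq> Some b" "chart s (F w) \<noteq> Some c" using om by metis+
    then show "p (F w) \<noteq> 0" "q (F w) \<noteq> 0"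
      by (auto simp: p_def q_def chart_def split: if_splits simp: field_simps)
  qed
  have uq: "u w = p (F w) / q (F w)" if w: "w \<in> ball z e" for w
    using e(3)[OF w] nz[OF w]
    by (cases s; cases "F w = 0") (auto simp: u_def p_def q_def chart_def field_simps)
  define \<kappa> where "\<kappa> = (if s then b - c else c - b)"
  have dF: "(F has_field_derivative deriv F z) (at z)" using e z holomorphic_derivI by blast
  define D where "D = \<kappa> * deriv F z / (q (F z))\<^sup>2"
  have "((\<lambda>v. p v / q v) has_field_derivative \<kappa> / (q (F z))\<^sup>2) (at (F z))"
    using nz(2)[OF z] unfolding p_def q_def \<kappa>_def
    by (cases s) (auto intro!: derivative_eq_intros simp: power2_eq_square field_simps)
  from DERIV_chain2[OF this dF] have "((\<lambda>w. p (F w) / q (F w)) has_field_derivative D) (at z)"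
    by (simp add: D_def)
  moreover have "\<forall>\<^sub>F w in nhds z. p (F w) / q (F w) = u w" using ev by eventually_elim (simp add: uq)
  ultimately have du: "(u has_field_derivative D) (at z)"
    using DERIV_cong_ev[OF refl _ refl, of "\<lambda>w. p (F w) / q (F w)" u z D] by simp
  have sd: "spherical_deriv \<psi> z = norm (deriv F z) / (1 + (norm (F z))\<^sup>2)"
    by (rule spherical_deriv_chart[OF open_ball z e(2,3)])
  have P: "1 + (norm (F z))\<^sup>2 > 0" by (simp add: add_pos_nonneg)
  have D0: "D = 0 \<longleftrightarrow> spherical_deriv \<psi> z = 0"
    using sd P nz(2)[OF z] bc by (auto simp: D_def \<kappa>_def)
  have "norm D \<le> (4 + (norm b + norm c)\<^sup>2) / norm (b - c) * spherical_deriv \<psi> z" if "norm (u z) = 1"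
  proof -
    define Q where "Q = norm (q (F z))"
    define \<beta> where "\<beta> = norm (b - c)"
    have Q: "Q > 0" and \<beta>: "\<beta> > 0" using nz(2)[OF z] bc by (auto simp: Q_def \<beta>_def)
    have pq: "norm (p (F z)) = Q" using that uq[OF z] Q by (simp add: norm_divide Q_def field_simps)
    have t1: "norm (q (F z) - p (F z)) \<le> 2 * Q"
      using norm_triangle_ineq4[of "q (F z)" "p (F z)"] pq by (simp add: Q_def)
    have t2: "norm (c * p (F z) - b * q (F z)) \<le> (norm b + norm c) * Q"
      using norm_triangle_ineq4[of "c * p (F z)" "b * q (F z)"] pq by (simp add: Q_def norm_mult algebra_simps)
    have "\<beta>\<^sup>2 * (1 + (norm (F z))\<^sup>2) = (norm (q (F z) - p (F z)))\<^sup>2 + (norm (c * p (F z) - b * q (F z)))\<^sup>2"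
    proof (cases s)
      case True
      have "q (F z) - p (F z) = b - c" "c * p (F z) - b * q (F z) = (c - b) * F z"
        by (simp_all add: True p_def q_def algebra_simps)
      then show ?thesis by (simp add: norm_mult \<beta>_def norm_minus_commute power_mult_distrib distrib_left)
    next
      case False
      have "q (F z) - p (F z) = (b - c) * F z" "c * p (F z) - b * q (F z) = c - b"
        by (simp_all add: False p_def q_def algebra_simps)
      then show ?thesis by (simp add: norm_mult \<beta>_def norm_minus_commute power_mult_distrib distrib_left)
    qed
    also have "\<dots> \<le> (2 * Q)\<^sup>2 + ((norm b + norm c) * Q)\<^sup>2"
      by (intro add_mono power_mono t1 t2) auto
    also have "\<dots> = (4 + (norm b + norm c)\<^sup>2) * Q\<^sup>2"
      unfolding power_mult_distrib by (simp add: distrib_right[of 4])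
    finally have key: "\<beta>\<^sup>2 * (1 + (norm (F z))\<^sup>2) \<le> (4 + (norm b + norm c)\<^sup>2) * Q\<^sup>2" .
    have "norm D = \<beta> * norm (deriv F z) / Q\<^sup>2"
      by (simp add: D_def \<kappa>_def norm_mult norm_divide norm_power Q_def \<beta>_def norm_minus_commute)
    also have "\<dots> \<le> (4 + (norm b + norm c)\<^sup>2) / \<beta> * (norm (deriv F z) / (1 + (norm (F z))\<^sup>2))"
    proof -
      have "\<beta>\<^sup>2 * (1 + (norm (F z))\<^sup>2) * norm (deriv F z) \<le> (4 + (norm b + norm c)\<^sup>2) * Q\<^sup>2 * norm (deriv F z)"
        using key by (rule mult_right_mono) simp
      then show ?thesis using Q \<beta> P by (simp add: divide_simps power2_eq_square) (simp add: mult_ac)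
    qed
    finally show ?thesis by (simp add: sd \<beta>_def)
  qed
  then show ?thesis using du D0 by blast
qed

text \<open>
  The quotient \<open>u = (\<psi> - b) / (\<psi> - c)\<close> is \<open>exp \<phi>\<close> with \<open>\<phi>\<close> entire. Where \<open>Re \<phi> = 0\<close> one has
  \<open>|u| = 1\<close>, and there \<open>|\<phi>'| = |u'|\<close> is bounded; hence \<open>\<phi>\<close> is affine and nonconstant. Thus \<open>u\<close> takes
  the value \<open>(a - b) / (a - c)\<close>, which means \<open>\<psi> = a\<close>, at a point where its derivative is not 0.
\<close>

lemma no_entire_curve_omitting_two_ramified_over_third:
  assumes hol: "\<And>z. sphere_holomorphic_at \<psi> z" and bnd: "\<And>z. spherical_deriv \<psi> z \<le> K"
    and nonconst: "spherical_deriv \<psi> z0 \<noteq> 0"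
    and om: "\<And>z. \<psi> z \<noteq> Some b" "\<And>z. \<psi> z \<noteq> Some c"
    and ram: "\<And>z. \<psi> z = Some a \<Longrightarrow> spherical_deriv \<psi> z = 0"
    and distinct: "a \<noteq> b" "a \<noteq> c" "b \<noteq> c"
  shows False
proof -
  define u where "u = (\<lambda>w. case \<psi> w of None \<Rightarrow> 1 | Some v \<Rightarrow> (v - b) / (v - c))"
  define C where "C = (4 + (norm b + norm c)\<^sup>2) / norm (b - c)"
  have C: "C \<ge> 0" by (simp add: C_def)
  have "\<exists>D. (u has_field_derivative D) (at z) \<and> (D = 0 \<longleftrightarrow> spherical_deriv \<psi> z = 0) \<and>
     (norm (u z) = 1 \<longrightarrow> norm D \<le> C * spherical_deriv \<psi> z)" for z
    unfolding u_def C_def by (rule omitting_quotient_derivative[OF hol distinct(3) om])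
  then obtain D where D: "\<And>z. (u has_field_derivative D z) (at z)" "\<And>z. D z = 0 \<longleftrightarrow> spherical_deriv \<psi> z = 0"
    "\<And>z. norm (u z) = 1 \<Longrightarrow> norm (D z) \<le> C * spherical_deriv \<psi> z" by metis
  have hu: "u holomorphic_on UNIV" unfolding holomorphic_on_def field_differentiable_def
    using D(1) has_field_derivative_at_within by blast
  have unz: "u z \<noteq> 0" for z
    using om(1)[of z] om(2)[of z] by (cases "\<psi> z") (auto simp: u_def)
  obtain \<phi> where \<phi>: "\<phi> holomorphic_on UNIV" "\<And>z. exp (\<phi> z) = u z"
    using holomorphic_logarithm_exists[OF convex_UNIV open_UNIV hu unz] by (metis UNIV_I)
  have du: "D z = u z * deriv \<phi> z" for z
  proof -
    have "(\<phi> has_field_derivative deriv \<phi> z) (at z)" using \<phi> holomorphic_derivI by blast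
    then have "((\<lambda>z. exp (\<phi> z)) has_field_derivative exp (\<phi> z) * deriv \<phi> z) (at z)"
      by (auto intro!: derivative_eq_intros)
    then have "(u has_field_derivative u z * deriv \<phi> z) (at z)" by (simp add: \<phi>(2))
    then show ?thesis using D(1) DERIV_unique by blast
  qed
  obtain \<alpha> \<beta> where lin: "\<And>z. \<phi> z = \<alpha> * z + \<beta>"
  proof (rule entire_affine_if_deriv_bounded_where_Re_0[OF \<phi>(1)])
    fix z assume "Re (\<phi> z) = 0"
    then have 1: "norm (u z) = 1" by (simp add: norm_exp_eq_Re flip: \<phi>(2))
    then have "norm (deriv \<phi> z) = norm (D z)" by (simp add: du norm_mult)
    also have "\<dots> \<le> C * spherical_deriv \<psi> z" by (rule D(3)[OF 1])
    also have "\<dots> \<le> C * K" using bnd C by (intro mult_left_mono)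
    finally show "norm (deriv \<phi> z) \<le> C * K" .
  qed blast
  have d\<phi>: "deriv \<phi> z = \<alpha>" for z
    by (rule DERIV_imp_deriv) (use lin in \<open>auto intro!: derivative_eq_intros simp: lin[abs_def]\<close>)
  have \<alpha>: "\<alpha> \<noteq> 0" using nonconst D(2)[of z0] by (auto simp: du d\<phi>)
  define A where "A = (a - b) / (a - c)"
  have A: "A \<noteq> 0" "A \<noteq> 1" using distinct by (auto simp: A_def divide_simps)
  define z where "z = (Ln A - \<beta>) / \<alpha>"
  have "u z = A" using A(1) \<alpha> by (simp add: z_def lin flip: \<phi>(2))
  then obtain w where w: "\<psi> z = Some w" "(w - b) / (w - c) = A" using A(2) by (cases "\<psi> z") (auto simp: u_def)
  have "w \<noteq> c" using om(2) w by auto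
  then have "(w - b) * (a - c) = (a - b) * (w - c)" using w(2) distinct by (simp add: A_def field_simps)
  then have "(w - a) * (b - c) = 0" by (simp add: algebra_simps)
  then have "w = a" using distinct by simp
  then have "spherical_deriv \<psi> z = 0" using ram w by simp
  then have "D z = 0" using D(2) by simp
  then show False using unz \<alpha> by (simp add: du d\<phi>)
qed

section \<open>Rescaling\<close>

text \<open>
  Choose \<open>\<phi> n\<close> with large spherical derivative on the half disc and let \<open>\<zeta> n\<close> maximise
  \<open>(R - |w - z0|) \<phi>\<^sub>n\<^sup>#(w)\<close>, where \<open>\<phi>\<^sub>n\<^sup>#\<close> is the spherical derivative. The maxima \<open>M n\<close> tend to infinity.
  With \<open>\<rho> n\<close> the reciprocal of the spherical derivative at \<open>\<zeta> n\<close>, the distance of \<open>\<zeta> n\<close> to the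
  boundary circle is \<open>\<rho> n * M n\<close>, so that a displacement by \<open>\<rho> n * w\<close> with \<open>2 |w| \<le> M n\<close> at most
  halves this distance, and by maximality at most doubles the spherical derivative.
\<close>

lemma Zalcman_rescaling:
  assumes R: "R > 0" and hol: "\<And>\<phi> w. \<lbrakk>\<phi> \<in> \<Phi>; w \<in> cball z0 R\<rbrakk> \<Longrightarrow> sphere_holomorphic_at \<phi> w"
    and unbdd: "\<And>B. \<exists>\<phi>\<in>\<Phi>. \<exists>w\<in>ball z0 (R/2). spherical_deriv \<phi> w > B"
  obtains \<phi> \<zeta> \<rho> where "\<And>n::nat. \<phi> n \<in> \<Phi>" "\<And>n. \<rho> n > (0::real)" "\<rho> \<longlonglongrightarrow> 0" "\<And>n. \<zeta> n \<in> ball z0 R"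
    "\<And>n. \<rho> n * spherical_deriv (\<phi> n) (\<zeta> n) = 1"
    "\<And>L. \<forall>\<^sub>F n in sequentially. \<forall>w\<in>ball 0 L. \<zeta> n + of_real (\<rho> n) * w \<in> ball z0 R \<and>
        \<rho> n * spherical_deriv (\<phi> n) (\<zeta> n + of_real (\<rho> n) * w) \<le> 2"
proof -
  obtain \<phi> v where \<phi>: "\<And>n::nat. \<phi> n \<in> \<Phi>" "\<And>n. v n \<in> ball z0 (R/2)" "\<And>n. spherical_deriv (\<phi> n) (v n) > real n + 1"
  proof -
    have "\<forall>n::nat. \<exists>p. fst p \<in> \<Phi> \<and> snd p \<in> ball z0 (R/2) \<and> spherical_deriv (fst p) (snd p) > real n + 1"
      using unbdd by (metis fst_conv snd_conv)
    then obtain p where "\<forall>n::nat. fst (p n) \<in> \<Phi> \<and> snd (p n) \<in> ball z0 (R/2) \<and> spherical_deriv (fst (p n)) (snd (p n)) > real n + 1"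
      by metis
    then show ?thesis by (intro that[of "\<lambda>n. fst (p n)" "\<lambda>n. snd (p n)"]) auto
  qed
  define U where "U n w = (R - dist z0 w) * spherical_deriv (\<phi> n) w" for n w
  have "\<exists>x\<in>cball z0 R. \<forall>y\<in>cball z0 R. U n y \<le> U n x" for n
  proof (rule continuous_attains_sup)
    show "continuous_on (cball z0 R) (U n)" unfolding U_def
      by (intro continuous_intros continuous_on_spherical_deriv hol \<phi>)
  qed (use R in auto)
  then obtain \<zeta> where \<zeta>: "\<And>n. \<zeta> n \<in> cball z0 R" "\<And>n y. y \<in> cball z0 R \<Longrightarrow> U n y \<le> U n (\<zeta> n)" by metis
  define M where "M n = U n (\<zeta> n)" for n
  define S where "S n = spherical_deriv (\<phi> n) (\<zeta> n)" for n
  define \<rho> where "\<rho> n = 1 / S n" for n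
  define R' where "R' n = R - dist z0 (\<zeta> n)" for n
  have MRS: "M n = R' n * S n" for n by (simp add: M_def U_def R'_def S_def)
  have Mge: "M n \<ge> R / 2 * (real n + 1)" for n
  proof -
    have "R / 2 * (real n + 1) \<le> U n (v n)"
    proof -
      have "dist z0 (v n) < R / 2" using \<phi>(2)[of n] by simp
      then show ?thesis unfolding U_def using \<phi>(3)[of n] R by (intro mult_mono) auto
    qed
    also have "\<dots> \<le> M n" unfolding M_def by (rule \<zeta>(2)) (use \<phi>(2)[of n] R in auto)
    finally show ?thesis .
  qed
  have Mpos: "M n > 0" for n using Mge[of n] R by (smt (verit) half_gt_zero mult_pos_pos of_nat_0_le_iff)
  have R'0: "R' n \<ge> 0" "R' n \<le> R" for n using \<zeta>(1)[of n] by (auto simp: R'_def)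
  have pos: "R' n > 0" "S n > 0" for n
    using Mpos[of n] R'0[of n] spherical_deriv_nonneg[of "\<phi> n" "\<zeta> n"] unfolding MRS S_def
    by (auto simp: zero_less_mult_iff)
  have \<rho>pos: "\<rho> n > 0" for n using pos by (simp add: \<rho>_def)
  have \<rho>le: "\<rho> n \<le> 2 / (real n + 1)" for n
  proof -
    have "R / 2 * (real n + 1) \<le> R * S n" using Mge[of n] MRS[of n] R'0[of n] pos(2)[of n] by (smt (verit) mult_right_mono)
    then have "R * ((real n + 1) / 2) \<le> R * S n" by simp
    then have "(real n + 1) / 2 \<le> S n" using R by (simp only: mult_le_cancel_left_pos)
    then show ?thesis using pos(2)[of n] by (simp add: \<rho>_def field_simps)
  qed
  have "(\<lambda>n. 2 / (real n + 1)) \<longlonglongrightarrow> 0"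
    using LIMSEQ_Suc[OF lim_const_over_n[of "2::real"]] by (simp add: add.commute)
  then have \<rho>lim: "\<rho> \<longlonglongrightarrow> 0"
    by (intro tendsto_sandwich[OF _ _ tendsto_const, of "0" \<rho> sequentially "\<lambda>n. 2 / (real n + 1)"] always_eventually allI) (use \<rho>pos \<rho>le less_imp_le in auto)
  show ?thesis
  proof (rule that[of \<phi> \<rho> \<zeta>])
    show "\<zeta> n \<in> ball z0 R" for n using pos(1)[of n] by (simp add: R'_def)
    show "\<rho> n * spherical_deriv (\<phi> n) (\<zeta> n) = 1" for n using pos(2)[of n] by (simp add: \<rho>_def S_def)
    fix L :: real
    obtain N :: nat where N: "4 * \<bar>L\<bar> / R \<le> real N" using real_arch_simple by blast
    show "\<forall>\<^sub>F n in sequentially. \<forall>w\<in>ball 0 L. \<zeta> n + of_real (\<rho> n) * w \<in> ball z0 R \<and>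
        \<rho> n * spherical_deriv (\<phi> n) (\<zeta> n + of_real (\<rho> n) * w) \<le> 2"
      using eventually_ge_at_top[of N]
    proof eventually_elim
      case (elim n)
      show ?case
      proof
        fix w :: complex assume w: "w \<in> ball 0 L"
        define y where "y = \<zeta> n + of_real (\<rho> n) * w"
        have "4 * \<bar>L\<bar> / R \<le> real n" using N elim by simp
        then have "2 * \<bar>L\<bar> \<le> R / 2 * (real n + 1)" using R by (simp add: field_simps)
        then have "2 * L \<le> M n" using Mge[of n] by linarith
        then have "\<rho> n * (2 * L) \<le> \<rho> n * M n" using \<rho>pos[of n] by (intro mult_left_mono) auto
        also have "\<rho> n * M n = R' n" using pos(2)[of n] by (simp add: \<rho>_def MRS)
        finally have "\<rho> n * L \<le> R' n / 2" by simp
        moreover have "dist z0 y \<le> dist z0 (\<zeta> n) + \<rho> n * norm w"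
          using dist_triangle[of z0 y "\<zeta> n"] \<rho>pos[of n] by (simp add: y_def dist_norm norm_mult)
        moreover have "\<rho> n * norm w < \<rho> n * L" using w \<rho>pos[of n] by simp
        ultimately have half: "R' n / 2 < R - dist z0 y" by (simp add: R'_def)
        then have y: "dist z0 y < R" using pos(1)[of n] by linarith
        have "R' n / 2 * spherical_deriv (\<phi> n) y \<le> U n y"
          unfolding U_def using half spherical_deriv_nonneg by (intro mult_right_mono) auto
        also have "\<dots> \<le> R' n * S n" unfolding MRS[symmetric] M_def by (rule \<zeta>(2)) (use y in auto)
        finally have "spherical_deriv (\<phi> n) y \<le> 2 * S n" using pos(1)[of n] by simp
        then have "\<rho> n * spherical_deriv (\<phi> n) y \<le> 2" using pos(2)[of n] by (simp add: \<rho>_def field_simps)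
        then show "\<zeta> n + of_real (\<rho> n) * w \<in> ball z0 R \<and>
            \<rho> n * spherical_deriv (\<phi> n) (\<zeta> n + of_real (\<rho> n) * w) \<le> 2"
          using y by (simp add: y_def)
      qed
    qed
  qed (use \<phi> \<rho>pos \<rho>lim in auto)
qed

section \<open>Normality from shared values\<close>

lemma normal_family_if_spherical_deriv_locally_bounded:
  assumes D: "open D" "connected D" "D \<noteq> {}"
    and mero: "\<And>f. f \<in> \<F> \<Longrightarrow> f nicely_meromorphic_on D"
    and bnd: "\<And>z. z \<in> D \<Longrightarrow> \<exists>e>0. \<exists>B. ball z e \<subseteq> D \<and> (\<forall>f\<in>\<F>. \<forall>w\<in>ball z e. spherical_deriv (mero_value f) w \<le> B)"
  shows "normal_family D \<F>"
  unfolding normal_family_def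
proof (intro allI impI)
  fix f :: "nat \<Rightarrow> complex \<Rightarrow> complex" assume "range f \<subseteq> \<F>"
  then have f: "f n \<in> \<F>" for n by auto
  have "\<exists>e>0. \<exists>B. ball z e \<subseteq> D \<and> (\<forall>\<^sub>F n in sequentially. \<forall>w\<in>ball z e.
      sphere_holomorphic_at (mero_value (f n)) w \<and> spherical_deriv (mero_value (f n)) w \<le> B)" if "z \<in> D" for z
  proof -
    obtain e B where e: "e > 0" "ball z e \<subseteq> D" "\<forall>f\<in>\<F>. \<forall>w\<in>ball z e. spherical_deriv (mero_value f) w \<le> B"
      using bnd[OF \<open>z \<in> D\<close>] by blast
    have "\<forall>w\<in>ball z e. sphere_holomorphic_at (mero_value (f n)) w \<and> spherical_deriv (mero_value (f n)) w \<le> B" for n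
      using mero_value_sphere_holomorphic[OF mero[OF f]] e f by blast
    then have "\<forall>\<^sub>F n in sequentially. \<forall>w\<in>ball z e. sphere_holomorphic_at (mero_value (f n)) w \<and> spherical_deriv (mero_value (f n)) w \<le> B"
      by (intro always_eventually allI)
    then show ?thesis using e by blast
  qed
  from Marty[OF D(3) this] obtain r \<psi> where r: "strict_mono r"
    and conv: "\<forall>z\<in>D. \<exists>e>0. ball z e \<subseteq> D \<and> chart_convergent_on (ball z e) (\<lambda>n. mero_value (f (r n))) \<psi>"
    by blast
  have lim: "spherically_locally_uniform_limit D (\<lambda>n. mero_value (f (r n))) \<psi>"
    unfolding spherically_locally_uniform_limit_def
  proof
    fix z assume "z \<in> D"
    then obtain e where e: "e > 0" "ball z e \<subseteq> D" "chart_convergent_on (ball z e) (\<lambda>n. mero_value (f (r n))) \<psi>"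
      using conv by blast
    show "\<exists>U. open U \<and> z \<in> U \<and> U \<subseteq> D \<and> (\<forall>\<epsilon>>0. \<forall>\<^sub>F n in sequentially. \<forall>w\<in>U. spherical_dist (mero_value (f (r n)) w) (\<psi> w) < \<epsilon>)"
      using e chart_convergent_on_spherical_dist[OF e(3)] by (intro exI[of _ "ball z e"]) auto
  qed
  have hol: "sphere_holomorphic_at \<psi> z" if z: "z \<in> D" for z
  proof -
    obtain e where e: "e > 0" "chart_convergent_on (ball z e) (\<lambda>n. mero_value (f (r n))) \<psi>" using conv z by blast
    show ?thesis by (rule chart_convergent_on_sphere_holomorphic[OF e(2)]) (use e(1) in auto)
  qed
  have "(\<exists>g. g nicely_meromorphic_on D \<and> (\<forall>z\<in>D. \<psi> z = mero_value g z)) \<or> (\<forall>z\<in>D. \<psi> z = None)"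
  proof (cases "\<forall>z\<in>D. \<psi> z = None")
    case False
    then obtain z0 where z0: "z0 \<in> D" "\<psi> z0 \<noteq> None" by blast
    show ?thesis using sphere_holomorphic_imp_meromorphic[OF D(1,2) hol z0] by metis
  qed blast
  then show "\<exists>r \<psi>. strict_mono r \<and> spherically_locally_uniform_limit D (\<lambda>n. mero_value (f (r n))) \<psi> \<and>
      ((\<exists>g. g nicely_meromorphic_on D \<and> (\<forall>z\<in>D. \<psi> z = mero_value g z)) \<or> (\<forall>z\<in>D. \<psi> z = None))"
    using r lim by blast
qed

lemma deriv_rescaled_mero_value:
  assumes f: "f nicely_meromorphic_on D" and w: "z0 + of_real \<rho> * \<zeta> \<in> D" and np: "\<not> is_pole f (z0 + of_real \<rho> * \<zeta>)"
  shows "deriv (\<lambda>v. finite_value (mero_value f (z0 + of_real \<rho> * v))) \<zeta> = of_real \<rho> * deriv f (z0 + of_real \<rho> * \<zeta>)"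
proof -
  define g where "g v = z0 + of_real \<rho> * v" for v
  have "f analytic_on {g \<zeta>}" using nicely_meromorphic_on_imp_analytic_at[OF f w np] by (simp add: g_def)
  then obtain e where e: "e > 0" "f holomorphic_on ball (g \<zeta>) e" using analytic_on_def by auto
  have "continuous_on UNIV g" unfolding g_def by (intro continuous_intros)
  then have op: "open (g -` ball (g \<zeta>) e)" by (rule open_vimage[OF open_ball])
  have "deriv (\<lambda>v. finite_value (mero_value f (g v))) \<zeta> = deriv (\<lambda>v. f (g v)) \<zeta>"
  proof (rule deriv_cong_open[OF op])
    show "\<zeta> \<in> g -` ball (g \<zeta>) e" using e by simp
    fix v assume "v \<in> g -` ball (g \<zeta>) e"
    then have "\<not> is_pole f (g v)" using not_is_pole_holomorphic[OF open_ball _ e(2)] by simp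
    then show "finite_value (mero_value f (g v)) = f (g v)" by (simp add: mero_value_def)
  qed
  moreover have "((\<lambda>v. f (g v)) has_field_derivative deriv f (g \<zeta>) * of_real \<rho>) (at \<zeta>)"
  proof -
    have 1: "(f has_field_derivative deriv f (g \<zeta>)) (at (g \<zeta>))" using e holomorphic_derivI by (metis centre_in_ball open_ball)
    have 2: "(g has_field_derivative of_real \<rho>) (at \<zeta>)" unfolding g_def by (rule derivative_eq_intros refl | simp)+
    show ?thesis by (rule DERIV_chain2[OF 1 2])
  qed
  ultimately show ?thesis by (simp add: g_def DERIV_imp_deriv mult.commute)
qed

lemma partially_shareD:
  assumes "partially_share D f (deriv f) \<alpha> \<beta>" "w \<in> D" "mero_value f w = Some \<alpha>"
  shows "\<not> is_pole f w" "deriv f w = \<beta> w"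
  using assms unfolding partially_share_def by (auto simp: mero_value_def split: if_splits)

lemma spherical_deriv_zero_identity:
  assumes hol: "\<And>z. sphere_holomorphic_at \<psi> z" and ev: "\<forall>\<^sub>F w in nhds z0. spherical_deriv \<psi> w = 0"
  shows "spherical_deriv \<psi> z = 0"
proof (rule identity_principle_local_zero_sets[OF open_UNIV connected_UNIV _ _ ev])
  fix y
  obtain s F e where e: "0 < e" "F holomorphic_on ball y e" "\<And>w. w \<in> ball y e \<Longrightarrow> \<psi> w = chart s (F w)"
    using hol unfolding sphere_holomorphic_at_def by blast
  have "spherical_deriv \<psi> w = 0 \<longleftrightarrow> deriv F w = 0" if "w \<in> ball y e" for w
  proof -
    have "1 + (norm (F w))\<^sup>2 > 0" by (simp add: add_pos_nonneg)
    then show ?thesis using spherical_deriv_chart[OF open_ball that e(2,3)] by simp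
  qed
  moreover have "deriv F holomorphic_on ball y e" using e(2) by (simp add: holomorphic_deriv)
  ultimately show "\<exists>e>0. \<exists>H. ball y e \<subseteq> UNIV \<and> H holomorphic_on ball y e \<and> (\<forall>w\<in>ball y e. (spherical_deriv \<psi> w = 0) = (H w = 0))"
    using e(1) by blast
qed auto

text \<open>
  If the bound fails, the rescaled functions \<open>g n\<close> have a limit \<open>\<psi>\<close> on the plane. By the chain rule
  the shared derivatives are multiplied by the scale \<open>t n\<close>, which makes them small but does not make
  \<open>c\<^sub>f\<close> and \<open>d\<^sub>f\<close> vanish, so \<open>\<psi>\<close> has the properties excluded by
  \<open>no_entire_curve_omitting_two_ramified_over_third\<close>.
\<close>

lemma spherical_deriv_locally_bounded_of_sharing:
  fixes D :: "complex set" and \<F> :: "(complex \<Rightarrow> complex) set"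
    and a b c :: complex and h :: "complex \<Rightarrow> complex" and \<rho> :: real
  assumes D: "open D" and mero: "\<And>f. f \<in> \<F> \<Longrightarrow> f nicely_meromorphic_on D"
    and distinct: "a \<noteq> b" "a \<noteq> c" "b \<noteq> c"
    and h: "continuous_on D h"
    and share: "\<And>f. f \<in> \<F> \<Longrightarrow>
           \<exists>c\<^sub>f \<in> ball 0 \<rho> - {0}. \<exists>d\<^sub>f \<in> ball 0 \<rho> - {0}.
             partially_share D f (deriv f) a h \<and>
             partially_share D f (deriv f) b (\<lambda>_. c\<^sub>f) \<and>
             partially_share D f (deriv f) c (\<lambda>_. d\<^sub>f)"
    and z0: "z0 \<in> D"
  shows "\<exists>e>0. \<exists>B. ball z0 e \<subseteq> D \<and> (\<forall>f\<in>\<F>. \<forall>w\<in>ball z0 e. spherical_deriv (mero_value f) w \<le> B)"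
proof (rule ccontr)
  assume contra: "\<not> ?thesis"
  obtain R where R: "R > 0" "cball z0 R \<subseteq> D" using D z0 open_contains_cball by blast
  have "ball z0 (R/2) \<subseteq> D" using R ball_subset_cball by force
  then have unbdd: "\<exists>\<phi>\<in>mero_value ` \<F>. \<exists>w\<in>ball z0 (R/2). spherical_deriv \<phi> w > B" for B
    using contra R(1) by (metis half_gt_zero imageI not_le)
  have hol: "sphere_holomorphic_at \<phi> w" if "\<phi> \<in> mero_value ` \<F>" "w \<in> cball z0 R" for \<phi> w
    using that mero_value_sphere_holomorphic mero R(2) by blast
  obtain \<phi> \<zeta> and t :: "nat \<Rightarrow> real" where \<phi>: "\<And>n::nat. \<phi> n \<in> mero_value ` \<F>" and t: "\<And>n. t n > 0" "t \<longlonglongrightarrow> 0"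
    and \<zeta>: "\<And>n. \<zeta> n \<in> ball z0 R" and one: "\<And>n. t n * spherical_deriv (\<phi> n) (\<zeta> n) = 1"
    and two: "\<And>L. \<forall>\<^sub>F n in sequentially. \<forall>w\<in>ball 0 L. \<zeta> n + of_real (t n) * w \<in> ball z0 R \<and>
        t n * spherical_deriv (\<phi> n) (\<zeta> n + of_real (t n) * w) \<le> 2"
    by (rule Zalcman_rescaling[OF R(1) _ unbdd], (rule hol; assumption), (rule that; assumption))
  have "\<forall>n. \<exists>g. g \<in> \<F> \<and> \<phi> n = mero_value g" using \<phi> by blast
  then obtain f where f: "\<And>n. f n \<in> \<F>" "\<And>n. \<phi> n = mero_value (f n)" by metis
  define g where "g n w = \<phi> n (\<zeta> n + of_real (t n) * w)" for n w
  have holg: "sphere_holomorphic_at (g n) w" "spherical_deriv (g n) w = t n * spherical_deriv (\<phi> n) (\<zeta> n + of_real (t n) * w)"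
    if "\<zeta> n + of_real (t n) * w \<in> ball z0 R" for n w
  proof -
    have "\<zeta> n + of_real (t n) * w \<in> cball z0 R" using that by simp
    then have "sphere_holomorphic_at (\<phi> n) (\<zeta> n + of_real (t n) * w)" using hol \<phi> by blast
    from affine_sphere_holomorphic[OF this t(1)]
    show "sphere_holomorphic_at (g n) w" "spherical_deriv (g n) w = t n * spherical_deriv (\<phi> n) (\<zeta> n + of_real (t n) * w)"
      unfolding g_def by blast+
  qed
  have near: "\<forall>\<^sub>F n in sequentially. \<forall>w\<in>ball z e. \<zeta> n + of_real (t n) * w \<in> ball z0 R \<and>
      sphere_holomorphic_at (g n) w \<and> spherical_deriv (g n) w \<le> 2" for z e
    using two[of "norm z + e"]
  proof eventually_elim
    case (elim n)
    show ?case
    proof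
      fix w assume "w \<in> ball z e"
      then have "w \<in> ball 0 (norm z + e)" using dist_triangle[of 0 w z] by (simp add: dist_norm)
      then show "\<zeta> n + of_real (t n) * w \<in> ball z0 R \<and> sphere_holomorphic_at (g n) w \<and> spherical_deriv (g n) w \<le> 2"
        using elim holg by metis
    qed
  qed
  have "\<exists>e>0. \<exists>B. ball z e \<subseteq> UNIV \<and> (\<forall>\<^sub>F n in sequentially. \<forall>w\<in>ball z e. sphere_holomorphic_at (g n) w \<and> spherical_deriv (g n) w \<le> B)"
    for z
  proof (intro exI conjI)
    show "(0::real) < 1" "ball z 1 \<subseteq> UNIV" by auto
    show "\<forall>\<^sub>F n in sequentially. \<forall>w\<in>ball z 1. sphere_holomorphic_at (g n) w \<and> spherical_deriv (g n) w \<le> 2"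
      using near[of z 1] by eventually_elim blast
  qed
  from Marty[OF UNIV_not_empty this] obtain r \<psi> where r: "strict_mono r"
    and conv: "\<forall>z\<in>UNIV. \<exists>e>0. ball z e \<subseteq> UNIV \<and> chart_convergent_on (ball z e) (\<lambda>n. g (r n)) \<psi>"
    by blast
  have fr: "filterlim r sequentially sequentially" using r by (rule filterlim_subseq)
  have sph: "sphere_holomorphic_at \<psi> z" and lim: "(\<lambda>n. spherical_deriv (g (r n)) z) \<longlonglongrightarrow> spherical_deriv \<psi> z" for z
  proof -
    obtain e where e: "e > 0" "chart_convergent_on (ball z e) (\<lambda>n. g (r n)) \<psi>" using conv by blast
    show "sphere_holomorphic_at \<psi> z" by (rule chart_convergent_on_sphere_holomorphic[OF e(2)]) (use e(1) in auto)
    show "(\<lambda>n. spherical_deriv (g (r n)) z) \<longlonglongrightarrow> spherical_deriv \<psi> z"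
      by (rule chart_convergent_on_spherical_deriv[OF e(2)]) (use e(1) in auto)
  qed
  have "spherical_deriv (g n) 0 = 1" for n using holg(2)[of n 0] \<zeta>[of n] one[of n] by simp
  then have sd1: "spherical_deriv \<psi> 0 = 1" using LIMSEQ_unique[OF lim[of 0]] by simp
  have sd2: "spherical_deriv \<psi> z \<le> 2" for z
  proof (rule tendsto_upperbound[OF lim])
    show "\<forall>\<^sub>F n in sequentially. spherical_deriv (g (r n)) z \<le> 2"
      using eventually_compose_filterlim[OF near[of z 1] fr] by (auto elim: eventually_mono)
  qed simp
  have nonconst: "\<not> (\<forall>\<^sub>F w in nhds z. spherical_deriv \<psi> w = 0)" for z
    using spherical_deriv_zero_identity[OF sph, of z 0] sd1 by auto
  have tr: "(\<lambda>n. t (r n)) \<longlonglongrightarrow> 0" using LIMSEQ_subseq_LIMSEQ[OF t(2) r] by (simp add: o_def)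
  have dg: "\<not> is_pole (f n) (\<zeta> n + of_real (t n) * w) \<Longrightarrow> \<zeta> n + of_real (t n) * w \<in> ball z0 R \<Longrightarrow>
      deriv (\<lambda>v. finite_value (g n v)) w = of_real (t n) * deriv (f n) (\<zeta> n + of_real (t n) * w)" for n w
    unfolding g_def f(2) by (rule deriv_rescaled_mero_value[OF mero[OF f(1)]]) (use R(2) in auto)
  have omits: "\<psi> z \<noteq> Some \<beta>"
    if \<kappa>: "\<And>n. \<kappa> n \<in> ball 0 \<rho> - {0}" "\<And>n. partially_share D (f n) (deriv (f n)) \<beta> (\<lambda>_. \<kappa> n)" for z \<beta> \<kappa>
  proof -
    obtain e where e: "e > 0" "chart_convergent_on (ball z e) (\<lambda>n. g (r n)) \<psi>" using conv by blast
    show ?thesis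
    proof (rule limit_omits_simple_value[OF e nonconst])
      show "(\<lambda>n. of_real (t (r n)) * \<kappa> (r n)) \<longlonglongrightarrow> 0"
      proof (rule tendsto_0_le)
        show "(\<lambda>n. t (r n)) \<longlonglongrightarrow> 0" by (rule tr)
        show "\<forall>\<^sub>F n in sequentially. norm (of_real (t (r n)) * \<kappa> (r n)) \<le> norm (t (r n)) * \<rho>"
        proof (intro always_eventually allI)
          fix n
          have "norm (\<kappa> (r n)) \<le> \<rho>" using \<kappa>(1)[of "r n"] by simp
          then show "norm (of_real (t (r n)) * \<kappa> (r n)) \<le> norm (t (r n)) * \<rho>"
            by (simp add: norm_mult mult_left_mono)
        qed
      qed
      show "of_real (t (r n)) * \<kappa> (r n) \<noteq> 0" for n using \<kappa>(1)[of "r n"] t(1)[of "r n"] by simp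
      show "\<forall>\<^sub>F n in sequentially. \<forall>w\<in>ball z e. g (r n) w = Some \<beta> \<longrightarrow>
          deriv (\<lambda>v. finite_value (g (r n) v)) w = of_real (t (r n)) * \<kappa> (r n)"
        using eventually_compose_filterlim[OF near[of z e] fr]
      proof (eventually_elim, intro ballI impI)
        fix n w assume n: "\<forall>w\<in>ball z e. \<zeta> (r n) + of_real (t (r n)) * w \<in> ball z0 R \<and>
            sphere_holomorphic_at (g (r n)) w \<and> spherical_deriv (g (r n)) w \<le> 2"
          and w: "w \<in> ball z e" "g (r n) w = Some \<beta>"
        define y where "y = \<zeta> (r n) + of_real (t (r n)) * w"
        have y: "y \<in> ball z0 R" using n w(1) by (simp add: y_def)
        then have "y \<in> D" using R(2) by auto
        moreover have "mero_value (f (r n)) y = Some \<beta>" using w(2) by (simp add: g_def f(2) y_def)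
        ultimately have "\<not> is_pole (f (r n)) y" "deriv (f (r n)) y = \<kappa> (r n)"
          using partially_shareD[OF \<kappa>(2)] by blast+
        then show "deriv (\<lambda>v. finite_value (g (r n) v)) w = of_real (t (r n)) * \<kappa> (r n)"
          using dg[of "r n" w] y by (simp add: y_def)
      qed
    qed
  qed
  obtain \<kappa> \<kappa>' where \<kappa>: "\<And>n. \<kappa> n \<in> ball 0 \<rho> - {0}" "\<And>n. \<kappa>' n \<in> ball 0 \<rho> - {0}"
    and sa: "\<And>n. partially_share D (f n) (deriv (f n)) a h"
    and sb: "\<And>n. partially_share D (f n) (deriv (f n)) b (\<lambda>_. \<kappa> n)"
    and sc: "\<And>n. partially_share D (f n) (deriv (f n)) c (\<lambda>_. \<kappa>' n)"
    using share[OF f(1)] by metis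
  have "compact (h ` cball z0 R)" by (intro compact_continuous_image continuous_on_subset[OF h R(2)] compact_cball)
  then have "bounded (h ` cball z0 R)" by (rule compact_imp_bounded)
  then obtain H where "\<forall>v\<in>h ` cball z0 R. norm v \<le> H" unfolding bounded_iff by blast
  then have H: "norm (h y) \<le> H" if "y \<in> cball z0 R" for y using that by blast
  have ram: "spherical_deriv \<psi> z = 0" if za: "\<psi> z = Some a" for z
  proof -
    obtain e where e: "e > 0" "chart_convergent_on (ball z e) (\<lambda>n. g (r n)) \<psi>" using conv by blast
    show ?thesis
    proof (rule limit_ramified_value[OF e nonconst _ _ za])
      show "(\<lambda>n. t (r n) * H) \<longlonglongrightarrow> 0" by (rule tendsto_mult_left_zero[OF tr])
      show "\<forall>\<^sub>F n in sequentially. \<forall>w\<in>ball z e. g (r n) w = Some a \<longrightarrow>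
          norm (deriv (\<lambda>v. finite_value (g (r n) v)) w) \<le> t (r n) * H"
        using eventually_compose_filterlim[OF near[of z e] fr]
      proof (eventually_elim, intro ballI impI)
        fix n w assume n: "\<forall>w\<in>ball z e. \<zeta> (r n) + of_real (t (r n)) * w \<in> ball z0 R \<and>
            sphere_holomorphic_at (g (r n)) w \<and> spherical_deriv (g (r n)) w \<le> 2"
          and w: "w \<in> ball z e" "g (r n) w = Some a"
        define y where "y = \<zeta> (r n) + of_real (t (r n)) * w"
        have y: "y \<in> ball z0 R" using n w(1) by (simp add: y_def)
        then have yc: "y \<in> cball z0 R" by simp
        then have "y \<in> D" using R(2) by blast
        moreover have "mero_value (f (r n)) y = Some a" using w(2) by (simp add: g_def f(2) y_def)
        ultimately have "\<not> is_pole (f (r n)) y" "deriv (f (r n)) y = h y"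
          using partially_shareD[OF sa] by blast+
        then have "norm (deriv (\<lambda>v. finite_value (g (r n) v)) w) = t (r n) * norm (h y)"
          using dg[of "r n" w] y t(1)[of "r n"] by (simp add: y_def norm_mult)
        also have "\<dots> \<le> t (r n) * H" using H[OF yc] t(1)[of "r n"] by (intro mult_left_mono) auto
        finally show "norm (deriv (\<lambda>v. finite_value (g (r n) v)) w) \<le> t (r n) * H" .
      qed
    qed
  qed
  show False
    by (rule no_entire_curve_omitting_two_ramified_over_third[OF sph sd2, of 0 b c a])
       (use sd1 omits[OF \<kappa>(1) sb] omits[OF \<kappa>(2) sc] ram distinct in auto)
qed

theorem theorem2p3:
  fixes D :: "complex set" and \<F> :: "(complex \<Rightarrow> complex) set"
    and a b c :: complex and h :: "complex \<Rightarrow> complex" and \<rho> :: real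
  assumes "open D" and "connected D" and "D \<noteq> {}"
    and "\<And>f. f \<in> \<F> \<Longrightarrow> f nicely_meromorphic_on D"
    and "a \<noteq> b" and "a \<noteq> c" and "b \<noteq> c"
    and "h holomorphic_on D"
    and "\<rho> > 0"
    and "\<And>f. f \<in> \<F> \<Longrightarrow>
           \<exists>c\<^sub>f \<in> ball 0 \<rho> - {0}. \<exists>d\<^sub>f \<in> ball 0 \<rho> - {0}.
             partially_share D f (deriv f) a h \<and>
             partially_share D f (deriv f) b (\<lambda>_. c\<^sub>f) \<and>
             partially_share D f (deriv f) c (\<lambda>_. d\<^sub>f)"
  shows "normal_family D \<F>"
proof (rule normal_family_if_spherical_deriv_locally_bounded[OF assms(1-3) assms(4)])
  fix z assume z: "z \<in> D"
  show "\<exists>e>0. \<exists>B. ball z e \<subseteq> D \<and> (\<forall>f\<in>\<F>. \<forall>w\<in>ball z e. spherical_deriv (mero_value f) w \<le> B)"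
  proof (rule spherical_deriv_locally_bounded_of_sharing[where a = a and b = b and c = c and h = h and \<rho> = \<rho>])
    show "continuous_on D h" using assms(8) by (rule holomorphic_on_imp_continuous_on)
  qed (fact assms z)+
qed

end
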